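(* Let $\pi:F\to M$ be a symmetric bundle over $M$. Then there exists a unique linear connection on the vector bundle $F$ which is invariant under all symmetries $\sigma_x$, $x\in M$ (where $M$ is identified with the zero section of $F$, so that $\sigma_x$ means the symmetry $\sigma_{0_x}:F\to F$).
   Context: $\mathbb K$ is a commutative topological ring with dense unit group and with $2$ invertible (e.g. $\mathbb K=\mathbb R$); manifolds are smooth manifolds over $\mathbb K$ modelled on topological $\mathbb K$-modules. Here a map $f$ on an open set is $C^1$ if there is a continuous map $f^{[1]}$ with $f(x+tv)-f(x)=t\,f^{[1]}(x,v,t)$ whenever both sides are defined, with differential $df(x)v=f^{[1]}(x,v,0)$; $C^{k}$ and smoothness are defined inductively. For $\mathbb K=\mathbb R$ in finite dimension these are the usual notions. **Symmetric space.** A manifold $M$ with a smooth map $\mu:M\times M\to M$, $\mu(x,y)=:\sigma_x(y)$, such that for all $x,y,z$: $\mu(x,x)=x$; $\mu(x,\mu(x,y))=y$; $\mu(x,\mu(y,z))=\mu(\mu(x,y),\mu(x,z))$; and $T_x(\sigma_x)=-\mathrm{id}_{T_xM}$. Homomorphisms are smooth maps commuting with product maps. **Symmetric bundle.** A vector bundle $\pi:F\to M$ such that (SB1) $(F,\mu)$ and $(M,\mu_M)$ are symmetric spaces and $\pi$ is a homomorphism of symmetric spaces; (SB2) for all $p,q\in M$ the induced map $F_p\oplus F_q\to F_{\mu_M(p,q)}$, $(v,w)\mapsto\mu(v,w)$ is linear. Consequently the zero section is a homomorphism, and each $\sigma_{0_x}$, $x\in M$, is an automorphism of the vector bundle $F$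 covering $\sigma_x:M\to M$. **Linear connection on a vector bundle $F\to M$.** A bundle chart (a chart $U\subset E$ of $M$ and a trivialization $F|_U\cong U\times V$) identifies the fiber $(TF)_x$ of the bundle $TF\to M$ over $x\in U$ with $V\times E\times V\ni(u,v,z)$ ($u$ the point of $F_x$, $(v,z)$ the tangent vector with base component $v$ and fiber component $z$). A linear connection is a choice, for each $x\in M$, of a $\mathbb K$-module structure on $(TF)_x$ such that in bundle charts it is the transport of the product $\mathbb K$-module structure of $V\times E\times V$ under a bijection $(u,v,z)\mapsto(u,v,z+b_x(v,u))$ with $b_x:E\times V\to V$ bilinear and $(x,v,u)\mapsto b_x(v,u)$ smooth ("bilinearly related to the linear structures induced by bundle charts"). In the real finite-dimensional case this is the usual notion of linear connection. A linear connection is invariant under an automorphism $f$ of the vector bundle $F$ covering $f_M:M\to M$ if $Tf:(TF)_x\to(TF)_{f_M(x)}$ is $\mathbb K$-linear for these structures for all $x$. *)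

theory Defs
  imports "HOL-Analysis.Analysis"
begin

section \<open>Topological modules over a topological ring\<close>

text \<open>The base ring is a type of sort \<open>{comm_ring_1, topological_ab_group_add, topological_semigroup_mult}\<close>;
  density of its unit group is an explicit hypothesis where it is needed.  A Hausdorff topological
  module is a Hausdorff topological group together with a jointly continuous scalar multiplication.\<close>

locale topological_module = module scale
  for scale :: "'k::{comm_ring_1, topological_ab_group_add, topological_semigroup_mult}
    \<Rightarrow> 'e::{topological_ab_group_add, t2_space} \<Rightarrow> 'e" +
  assumes continuous_scale: "continuous_on UNIV (\<lambda>(r, x). scale r x)"

definition prod_scale :: "('k \<Rightarrow> 'a \<Rightarrow> 'a) \<Rightarrow> ('k \<Rightarrow> 'b \<Rightarrow> 'b) \<Rightarrow> 'k \<Rightarrow> 'a \<times> 'b \<Rightarrow> 'a \<times> 'b" where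
  "prod_scale s t r = map_prod (s r) (t r)"


section \<open>Differential calculus\<close>

text \<open>The map \<open>f\<^sup>[\<^sup>1\<^sup>]\<close> lives on a subset of \<open>E \<times> E \<times> K\<close>, so the inductive definition of the class
  \<open>C\<^sup>k\<close> passes through the modules \<open>E\<^sup>[\<^sup>0\<^sup>] = E\<close> and \<open>E\<^sup>[\<^sup>n\<^sup>+\<^sup>1\<^sup>] = E\<^sup>[\<^sup>n\<^sup>] \<times> E\<^sup>[\<^sup>n\<^sup>] \<times> K\<close>.  They have
  different types, hence their points are collected in one datatype: the points of \<open>E\<^sup>[\<^sup>n\<^sup>]\<close> are the
  trees in \<open>pts n\<close>, where \<open>Ext p v t\<close> stands for the triple \<open>(p, v, t)\<close>.\<close>

datatype ('e, 'k) pt = Base 'e | Ext "('e, 'k) pt" "('e, 'k) pt" 'k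

primrec un_base :: "('e, 'k) pt \<Rightarrow> 'e" where
  "un_base (Base x) = x"

primrec un_ext :: "('e, 'k) pt \<Rightarrow> ('e, 'k) pt \<times> ('e, 'k) pt \<times> 'k" where
  "un_ext (Ext p v t) = (p, v, t)"

primrec pts :: "nat \<Rightarrow> ('e, 'k) pt set" where
  "pts 0 = range Base"
| "pts (Suc n) = {Ext p v t | p v t. p \<in> pts n \<and> v \<in> pts n}"

primrec pt_top :: "nat \<Rightarrow> ('e::topological_space, 'k::topological_space) pt topology" where
  "pt_top 0 = pullback_topology (pts 0) un_base euclidean"
| "pt_top (Suc n) = pullback_topology (pts (Suc n)) un_ext
     (prod_topology (pt_top n) (prod_topology (pt_top n) euclidean))"

text \<open>The module operations of \<open>E\<^sup>[\<^sup>n\<^sup>]\<close>; sums of trees of different shape are irrelevant.\<close>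

fun pt_add :: "('e::plus, 'k::plus) pt \<Rightarrow> ('e, 'k) pt \<Rightarrow> ('e, 'k) pt" where
  "pt_add (Base x) (Base y) = Base (x + y)"
| "pt_add (Ext p v t) (Ext q w s) = Ext (pt_add p q) (pt_add v w) (t + s)"
| "pt_add _ _ = undefined"

primrec pt_scale :: "('k::times \<Rightarrow> 'e \<Rightarrow> 'e) \<Rightarrow> 'k \<Rightarrow> ('e, 'k) pt \<Rightarrow> ('e, 'k) pt" where
  "pt_scale s r (Base x) = Base (s r x)"
| "pt_scale s r (Ext p v t) = Ext (pt_scale s r p) (pt_scale s r v) (r * t)"

text \<open>\<open>D\<^sup>[\<^sup>1\<^sup>] = {(p, v, t). p \<in> D, p + t v \<in> D}\<close> for \<open>D \<subseteq> E\<^sup>[\<^sup>n\<^sup>]\<close>.\<close>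

definition ext_dom :: "('k::{plus,times} \<Rightarrow> 'e::plus \<Rightarrow> 'e) \<Rightarrow> nat \<Rightarrow> ('e, 'k) pt set \<Rightarrow> ('e, 'k) pt set" where
  "ext_dom s n D = {Ext p v t | p v t. p \<in> D \<and> v \<in> pts n \<and> pt_add p (pt_scale s t v) \<in> D}"

definition diff_quot ::
  "('k::{topological_space, comm_ring_1} \<Rightarrow> 'e::{topological_space, ab_group_add} \<Rightarrow> 'e)
   \<Rightarrow> ('k \<Rightarrow> 'f::{topological_space, ab_group_add} \<Rightarrow> 'f)
   \<Rightarrow> nat \<Rightarrow> ('e, 'k) pt set \<Rightarrow> (('e, 'k) pt \<Rightarrow> 'f) \<Rightarrow> (('e, 'k) pt \<Rightarrow> 'f) \<Rightarrow> bool" where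
  "diff_quot sE sF n D f g \<longleftrightarrow>
     continuous_map (subtopology (pt_top (Suc n)) (ext_dom sE n D)) euclidean g \<and>
     (\<forall>p v t. Ext p v t \<in> ext_dom sE n D \<longrightarrow>
        f (pt_add p (pt_scale sE t v)) - f p = sF t (g (Ext p v t)))"

text \<open>\<open>Ck sE sF k n D f\<close>: the map \<open>f\<close> on \<open>D \<subseteq> E\<^sup>[\<^sup>n\<^sup>]\<close> is of class \<open>C\<^sup>k\<close>.\<close>

primrec Ck ::
  "('k::{topological_space, comm_ring_1} \<Rightarrow> 'e::{topological_space, ab_group_add} \<Rightarrow> 'e)
   \<Rightarrow> ('k \<Rightarrow> 'f::{topological_space, ab_group_add} \<Rightarrow> 'f)
   \<Rightarrow> nat \<Rightarrow> nat \<Rightarrow> ('e, 'k) pt set \<Rightarrow> (('e, 'k) pt \<Rightarrow> 'f) \<Rightarrow> bool" where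
  "Ck sE sF 0 = (\<lambda>n D f. continuous_map (subtopology (pt_top n) D) euclidean f)"
| "Ck sE sF (Suc k) = (\<lambda>n D f. \<exists>g. diff_quot sE sF n D f g \<and> Ck sE sF k (Suc n) (ext_dom sE n D) g)"

definition smooth_on ::
  "('k::{topological_space, comm_ring_1} \<Rightarrow> 'e::{topological_space, ab_group_add} \<Rightarrow> 'e)
   \<Rightarrow> ('k \<Rightarrow> 'f::{topological_space, ab_group_add} \<Rightarrow> 'f) \<Rightarrow> 'e set \<Rightarrow> ('e \<Rightarrow> 'f) \<Rightarrow> bool" where
  "smooth_on sE sF U f \<longleftrightarrow> open U \<and> (\<forall>k. Ck sE sF k 0 (Base ` U) (f \<circ> un_base))"

text \<open>\<open>df(x)v = f\<^sup>[\<^sup>1\<^sup>](x, v, 0)\<close>, well defined when the units are dense and the target is Hausdorff.\<close>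

definition differential ::
  "('k::{topological_space, comm_ring_1} \<Rightarrow> 'e::{topological_space, ab_group_add} \<Rightarrow> 'e)
   \<Rightarrow> ('k \<Rightarrow> 'f::{topological_space, ab_group_add} \<Rightarrow> 'f) \<Rightarrow> 'e set \<Rightarrow> ('e \<Rightarrow> 'f) \<Rightarrow> 'e \<Rightarrow> 'e \<Rightarrow> 'f" where
  "differential sE sF U f x v =
     (THE w. \<exists>g. diff_quot sE sF 0 (Base ` U) (f \<circ> un_base) g \<and> w = g (Ext (Base x) (Base v) 0))"


section \<open>Manifolds and tangent spaces\<close>

text \<open>A chart is a pair of its domain and its coordinate map; the values of the coordinate map
  outside the domain are irrelevant.  Atlases are not required to be maximal, and manifolds
  are not required to be Hausdorff.\<close>

type_synonym ('m, 'e) chart = "'m set \<times> ('m \<Rightarrow> 'e)"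

definition chart_inv :: "('m, 'e) chart \<Rightarrow> 'e \<Rightarrow> 'm" where
  "chart_inv c = inv_into (fst c) (snd c)"

definition is_chart :: "('m::topological_space, 'e::topological_space) chart \<Rightarrow> bool" where
  "is_chart c \<longleftrightarrow> open (fst c) \<and> open (snd c ` fst c) \<and>
     homeomorphism (fst c) (snd c ` fst c) (snd c) (chart_inv c)"

text \<open>The expression of a map \<open>f\<close> in charts \<open>c\<close> and \<open>d\<close>, with its natural domain; for \<open>f = id\<close>
  this is the transition map from \<open>c\<close> to \<open>d\<close>.\<close>

definition loc_dom :: "('m, 'e) chart \<Rightarrow> ('m \<Rightarrow> 'n) \<Rightarrow> ('n, 'f) chart \<Rightarrow> 'e set" where
  "loc_dom c f d = snd c ` (fst c \<inter> f -` fst d)"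

definition loc_map :: "('m, 'e) chart \<Rightarrow> ('m \<Rightarrow> 'n) \<Rightarrow> ('n, 'f) chart \<Rightarrow> 'e \<Rightarrow> 'f" where
  "loc_map c f d = snd d \<circ> f \<circ> chart_inv c"

definition is_atlas ::
  "('k::{topological_space, comm_ring_1} \<Rightarrow> 'e::{topological_space, ab_group_add} \<Rightarrow> 'e)
   \<Rightarrow> ('m::topological_space, 'e) chart set \<Rightarrow> bool" where
  "is_atlas sE A \<longleftrightarrow> (\<forall>c\<in>A. is_chart c) \<and> (\<Union>c\<in>A. fst c) = UNIV \<and>
     (\<forall>c\<in>A. \<forall>d\<in>A. smooth_on sE sE (loc_dom c id d) (loc_map c id d))"

definition smooth_map ::
  "('k::{topological_space, comm_ring_1} \<Rightarrow> 'e::{topological_space, ab_group_add} \<Rightarrow> 'e)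
   \<Rightarrow> ('m::topological_space, 'e) chart set
   \<Rightarrow> ('k \<Rightarrow> 'f::{topological_space, ab_group_add} \<Rightarrow> 'f)
   \<Rightarrow> ('n::topological_space, 'f) chart set \<Rightarrow> ('m \<Rightarrow> 'n) \<Rightarrow> bool" where
  "smooth_map sE A sF B f \<longleftrightarrow> continuous_on UNIV f \<and>
     (\<forall>c\<in>A. \<forall>d\<in>B. smooth_on sE sF (loc_dom c f d) (loc_map c f d))"

definition prod_atlas ::
  "('m, 'e) chart set \<Rightarrow> ('n, 'f) chart set \<Rightarrow> ('m \<times> 'n, 'e \<times> 'f) chart set" where
  "prod_atlas A B = {(fst c \<times> fst d, map_prod (snd c) (snd d)) | c d. c \<in> A \<and> d \<in> B}"

definition charts_at :: "('m, 'e) chart set \<Rightarrow> 'm \<Rightarrow> ('m, 'e) chart set" where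
  "charts_at A p = {c \<in> A. p \<in> fst c}"

text \<open>A tangent vector at \<open>p\<close> is the family of its coordinates in all charts at \<open>p\<close>, related by the
  differentials of the transition maps (and \<open>0\<close> for all other indices).  The module operations
  on tangent spaces are the pointwise ones.\<close>

definition tangent_space ::
  "('k::{topological_space, comm_ring_1} \<Rightarrow> 'e::{topological_space, ab_group_add} \<Rightarrow> 'e)
   \<Rightarrow> ('m, 'e) chart set \<Rightarrow> 'm \<Rightarrow> (('m, 'e) chart \<Rightarrow> 'e) set" where
  "tangent_space sE A p = {\<xi>.
     (\<forall>c\<in>charts_at A p. \<forall>d\<in>charts_at A p.
        \<xi> d = differential sE sE (loc_dom c id d) (loc_map c id d) (snd c p) (\<xi> c)) \<and>
     (\<forall>c. c \<notin> charts_at A p \<longrightarrow> \<xi> c = 0)}"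

text \<open>\<open>tangent_map sE A sF B f p\<close> is \<open>T\<^sub>p f\<close> for a smooth map \<open>f\<close>; the result does not depend on
  the chosen chart \<open>c\<close> at \<open>p\<close>.\<close>

definition tangent_map ::
  "('k::{topological_space, comm_ring_1} \<Rightarrow> 'e::{topological_space, ab_group_add} \<Rightarrow> 'e)
   \<Rightarrow> ('m, 'e) chart set
   \<Rightarrow> ('k \<Rightarrow> 'f::{topological_space, ab_group_add} \<Rightarrow> 'f)
   \<Rightarrow> ('n, 'f) chart set
   \<Rightarrow> ('m \<Rightarrow> 'n) \<Rightarrow> 'm \<Rightarrow> (('m, 'e) chart \<Rightarrow> 'e) \<Rightarrow> ('n, 'f) chart \<Rightarrow> 'f" where
  "tangent_map sE A sF B f p \<xi> = (\<lambda>d.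
     if d \<in> charts_at B (f p)
     then let c = (SOME c. c \<in> charts_at A p)
          in differential sE sF (loc_dom c f d) (loc_map c f d) (snd c p) (\<xi> c)
     else 0)"


section \<open>Symmetric spaces\<close>

definition symmetric_space ::
  "('k::{topological_space, comm_ring_1} \<Rightarrow> 'e::{topological_space, ab_group_add} \<Rightarrow> 'e)
   \<Rightarrow> ('m::topological_space, 'e) chart set \<Rightarrow> ('m \<Rightarrow> 'm \<Rightarrow> 'm) \<Rightarrow> bool" where
  "symmetric_space sE A \<mu> \<longleftrightarrow>
     is_atlas sE A \<and>
     smooth_map (prod_scale sE sE) (prod_atlas A A) sE A (\<lambda>(x, y). \<mu> x y) \<and>
     (\<forall>x. \<mu> x x = x) \<and>
     (\<forall>x y. \<mu> x (\<mu> x y) = y) \<and>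
     (\<forall>x y z. \<mu> x (\<mu> y z) = \<mu> (\<mu> x y) (\<mu> x z)) \<and>
     (\<forall>x. \<forall>\<xi>\<in>tangent_space sE A x. tangent_map sE A sE A (\<mu> x) x \<xi> = (\<lambda>c. - \<xi> c))"

definition symmetric_space_hom ::
  "('k::{topological_space, comm_ring_1} \<Rightarrow> 'e::{topological_space, ab_group_add} \<Rightarrow> 'e)
   \<Rightarrow> ('m::topological_space, 'e) chart set \<Rightarrow> ('m \<Rightarrow> 'm \<Rightarrow> 'm)
   \<Rightarrow> ('k \<Rightarrow> 'f::{topological_space, ab_group_add} \<Rightarrow> 'f)
   \<Rightarrow> ('n::topological_space, 'f) chart set \<Rightarrow> ('n \<Rightarrow> 'n \<Rightarrow> 'n) \<Rightarrow> ('m \<Rightarrow> 'n) \<Rightarrow> bool" where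
  "symmetric_space_hom sE A \<mu> sF B \<nu> f \<longleftrightarrow>
     smooth_map sE A sF B f \<and> (\<forall>x y. f (\<mu> x y) = \<nu> (f x) (f y))"


section \<open>Module structures on sets\<close>

record ('a, 'k) kmod =
  kadd :: "'a \<Rightarrow> 'a \<Rightarrow> 'a"
  kzero :: 'a
  kscale :: "'k \<Rightarrow> 'a \<Rightarrow> 'a"

definition module_structure :: "'a set \<Rightarrow> ('a, 'k::comm_ring_1) kmod \<Rightarrow> bool" where
  "module_structure S X \<longleftrightarrow>
     kzero X \<in> S \<and>
     (\<forall>x\<in>S. \<forall>y\<in>S. kadd X x y \<in> S) \<and>
     (\<forall>r. \<forall>x\<in>S. kscale X r x \<in> S) \<and>
     (\<forall>x\<in>S. \<forall>y\<in>S. \<forall>z\<in>S. kadd X (kadd X x y) z = kadd X x (kadd X y z)) \<and>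
     (\<forall>x\<in>S. \<forall>y\<in>S. kadd X x y = kadd X y x) \<and>
     (\<forall>x\<in>S. kadd X (kzero X) x = x) \<and>
     (\<forall>x\<in>S. \<exists>y\<in>S. kadd X x y = kzero X) \<and>
     (\<forall>r. \<forall>x\<in>S. \<forall>y\<in>S. kscale X r (kadd X x y) = kadd X (kscale X r x) (kscale X r y)) \<and>
     (\<forall>r s. \<forall>x\<in>S. kscale X (r + s) x = kadd X (kscale X r x) (kscale X s x)) \<and>
     (\<forall>r s. \<forall>x\<in>S. kscale X (r * s) x = kscale X r (kscale X s x)) \<and>
     (\<forall>x\<in>S. kscale X 1 x = x)"

text \<open>Normalization of the operations outside of the carrier, so that a module structure on \<open>S\<close>
  is determined by its operations on \<open>S\<close>.\<close>

definition module_extensional :: "'a set \<Rightarrow> ('a, 'k) kmod \<Rightarrow> bool" where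
  "module_extensional S X \<longleftrightarrow>
     (\<forall>x y. \<not> (x \<in> S \<and> y \<in> S) \<longrightarrow> kadd X x y = undefined) \<and>
     (\<forall>r x. x \<notin> S \<longrightarrow> kscale X r x = undefined)"

definition type_module :: "('k \<Rightarrow> 'a \<Rightarrow> 'a) \<Rightarrow> ('a::ab_group_add, 'k) kmod" where
  "type_module s = \<lparr>kadd = (+), kzero = 0, kscale = s\<rparr>"

definition sum_module :: "('a, 'k) kmod \<Rightarrow> ('b, 'k) kmod \<Rightarrow> ('a \<times> 'b, 'k) kmod" where
  "sum_module X Y =
     \<lparr>kadd = (\<lambda>(x, y) (x', y'). (kadd X x x', kadd Y y y')),
      kzero = (kzero X, kzero Y),
      kscale = (\<lambda>r (x, y). (kscale X r x, kscale Y r y))\<rparr>"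

definition klinear :: "'a set \<Rightarrow> ('a, 'k) kmod \<Rightarrow> 'b set \<Rightarrow> ('b, 'k) kmod \<Rightarrow> ('a \<Rightarrow> 'b) \<Rightarrow> bool" where
  "klinear S X T Y f \<longleftrightarrow>
     f \<in> S \<rightarrow> T \<and>
     (\<forall>x\<in>S. \<forall>y\<in>S. f (kadd X x y) = kadd Y (f x) (f y)) \<and>
     (\<forall>r. \<forall>x\<in>S. f (kscale X r x) = kscale Y r (f x))"

definition kiso :: "'a set \<Rightarrow> ('a, 'k) kmod \<Rightarrow> 'b set \<Rightarrow> ('b, 'k) kmod \<Rightarrow> ('a \<Rightarrow> 'b) \<Rightarrow> bool" where
  "kiso S X T Y f \<longleftrightarrow> klinear S X T Y f \<and> bij_betw f S T"


section \<open>Vector bundles and symmetric bundles\<close>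

definition fiber :: "('f \<Rightarrow> 'm) \<Rightarrow> 'm \<Rightarrow> 'f set" where
  "fiber \<pi> x = \<pi> -` {x}"

text \<open>A bundle chart of \<open>\<pi>: F \<rightarrow> M\<close> over a chart \<open>c\<close> of \<open>M\<close> is a chart \<open>C\<close> of \<open>F\<close> with values in \<open>E \<times> V\<close>
  which is defined on the preimage of the domain of \<open>c\<close>, covers \<open>c\<close>, and is a linear isomorphism
  from each fiber onto \<open>V\<close>.  \<open>X x\<close> is the module structure of the fiber over \<open>x\<close>.\<close>

definition bundle_chart ::
  "('k \<Rightarrow> 'v::ab_group_add \<Rightarrow> 'v) \<Rightarrow> ('f \<Rightarrow> 'm) \<Rightarrow> ('m \<Rightarrow> ('f, 'k) kmod)
   \<Rightarrow> ('m, 'e) chart \<Rightarrow> ('f, 'e \<times> 'v) chart \<Rightarrow> bool" where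
  "bundle_chart sV \<pi> X c C \<longleftrightarrow>
     fst C = \<pi> -` fst c \<and>
     (\<forall>y\<in>fst C. fst (snd C y) = snd c (\<pi> y)) \<and>
     (\<forall>x\<in>fst c. kiso (fiber \<pi> x) (X x) UNIV (type_module sV) (\<lambda>y. snd (snd C y)))"

definition vector_bundle ::
  "('k::{topological_space, comm_ring_1} \<Rightarrow> 'e::{topological_space, ab_group_add} \<Rightarrow> 'e)
   \<Rightarrow> ('k \<Rightarrow> 'v::{topological_space, ab_group_add} \<Rightarrow> 'v)
   \<Rightarrow> ('m::topological_space, 'e) chart set \<Rightarrow> ('f::topological_space, 'e \<times> 'v) chart set
   \<Rightarrow> ('f \<Rightarrow> 'm) \<Rightarrow> ('m \<Rightarrow> ('f, 'k) kmod) \<Rightarrow> bool" where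
  "vector_bundle sE sV A B \<pi> X \<longleftrightarrow>
     is_atlas sE A \<and> is_atlas (prod_scale sE sV) B \<and>
     (\<forall>x. module_structure (fiber \<pi> x) (X x)) \<and>
     (\<forall>C\<in>B. \<exists>c\<in>A. bundle_chart sV \<pi> X c C)"

definition symmetric_bundle ::
  "('k::{topological_space, comm_ring_1} \<Rightarrow> 'e::{topological_space, ab_group_add} \<Rightarrow> 'e)
   \<Rightarrow> ('k \<Rightarrow> 'v::{topological_space, ab_group_add} \<Rightarrow> 'v)
   \<Rightarrow> ('m::topological_space, 'e) chart set \<Rightarrow> ('f::topological_space, 'e \<times> 'v) chart set
   \<Rightarrow> ('f \<Rightarrow> 'm) \<Rightarrow> ('m \<Rightarrow> ('f, 'k) kmod)
   \<Rightarrow> ('m \<Rightarrow> 'm \<Rightarrow> 'm) \<Rightarrow> ('f \<Rightarrow> 'f \<Rightarrow> 'f) \<Rightarrow> bool" where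
  "symmetric_bundle sE sV A B \<pi> X \<mu>M \<mu> \<longleftrightarrow>
     vector_bundle sE sV A B \<pi> X \<and>
     symmetric_space sE A \<mu>M \<and>
     symmetric_space (prod_scale sE sV) B \<mu> \<and>
     symmetric_space_hom (prod_scale sE sV) B \<mu> sE A \<mu>M \<pi> \<and>
     (\<forall>p q. klinear (fiber \<pi> p \<times> fiber \<pi> q) (sum_module (X p) (X q))
              (fiber \<pi> (\<mu>M p q)) (X (\<mu>M p q)) (\<lambda>(v, w). \<mu> v w))"


section \<open>Linear connections\<close>

text \<open>\<open>TF_fiber \<dots> x\<close> is the fiber over \<open>x \<in> M\<close> of the bundle \<open>TF \<rightarrow> M\<close>; its elements are pairs of a point
  \<open>u\<close> of \<open>F\<close> over \<open>x\<close> and a tangent vector of \<open>F\<close> at \<open>u\<close>.  A bundle chart \<open>C\<close> identifies it with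
  \<open>V \<times> E \<times> V\<close>.\<close>

definition TF_fiber ::
  "('k::{topological_space, comm_ring_1} \<Rightarrow> 'e::{topological_space, ab_group_add} \<Rightarrow> 'e)
   \<Rightarrow> ('k \<Rightarrow> 'v::{topological_space, ab_group_add} \<Rightarrow> 'v)
   \<Rightarrow> ('f, 'e \<times> 'v) chart set \<Rightarrow> ('f \<Rightarrow> 'm) \<Rightarrow> 'm
   \<Rightarrow> ('f \<times> (('f, 'e \<times> 'v) chart \<Rightarrow> 'e \<times> 'v)) set" where
  "TF_fiber sE sV B \<pi> x =
     {(u, \<xi>). u \<in> fiber \<pi> x \<and> \<xi> \<in> tangent_space (prod_scale sE sV) B u}"

definition TF_coord ::
  "('f, 'e \<times> 'v) chart \<Rightarrow> 'f \<times> (('f, 'e \<times> 'v) chart \<Rightarrow> 'e \<times> 'v) \<Rightarrow> 'v \<times> 'e \<times> 'v" where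
  "TF_coord C = (\<lambda>(u, \<xi>). (snd (snd C u), fst (\<xi> C), snd (\<xi> C)))"

text \<open>The linear structure of \<open>(TF)\<^sub>x\<close> is the transport of the product structure of \<open>V \<times> E \<times> V\<close> under
  \<open>(u, v, z) \<mapsto> (u, v, z + b\<^sub>x(v, u))\<close>, i.e. the chart followed by the inverse
  \<open>(u, v, z) \<mapsto> (u, v, z - b\<^sub>x(v, u))\<close> is an isomorphism of modules.  The coordinate of the base
  point \<open>x\<close> in the chart is \<open>fst (snd C u)\<close>, for any \<open>u\<close> over \<open>x\<close>.\<close>

definition linear_connection ::
  "('k::{topological_space, comm_ring_1} \<Rightarrow> 'e::{topological_space, ab_group_add} \<Rightarrow> 'e)
   \<Rightarrow> ('k \<Rightarrow> 'v::{topological_space, ab_group_add} \<Rightarrow> 'v)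
   \<Rightarrow> ('f, 'e \<times> 'v) chart set \<Rightarrow> ('f \<Rightarrow> 'm)
   \<Rightarrow> ('m \<Rightarrow> ('f \<times> (('f, 'e \<times> 'v) chart \<Rightarrow> 'e \<times> 'v), 'k) kmod) \<Rightarrow> bool" where
  "linear_connection sE sV B \<pi> \<Gamma> \<longleftrightarrow>
     (\<forall>x. module_structure (TF_fiber sE sV B \<pi> x) (\<Gamma> x) \<and>
          module_extensional (TF_fiber sE sV B \<pi> x) (\<Gamma> x)) \<and>
     (\<forall>C\<in>B. \<exists>b :: 'e \<Rightarrow> 'e \<Rightarrow> 'v \<Rightarrow> 'v.
        smooth_on (prod_scale sE (prod_scale sE sV)) sV
          ((fst ` snd C ` fst C) \<times> UNIV \<times> UNIV) (\<lambda>(y, v, u). b y v u) \<and>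
        (\<forall>y \<in> fst ` snd C ` fst C.
           (\<forall>u. module_hom sE sV (\<lambda>v. b y v u)) \<and> (\<forall>v. module_hom sV sV (\<lambda>u. b y v u))) \<and>
        (\<forall>x \<in> \<pi> ` fst C.
           kiso (TF_fiber sE sV B \<pi> x) (\<Gamma> x)
             UNIV (sum_module (type_module sV) (sum_module (type_module sE) (type_module sV)))
             (\<lambda>\<tau>. let (u, v, z) = TF_coord C \<tau>; y = fst (snd C (fst \<tau>)) in (u, v, z - b y v u))))"

definition invariant_connection ::
  "('k::{topological_space, comm_ring_1} \<Rightarrow> 'e::{topological_space, ab_group_add} \<Rightarrow> 'e)
   \<Rightarrow> ('k \<Rightarrow> 'v::{topological_space, ab_group_add} \<Rightarrow> 'v)
   \<Rightarrow> ('f, 'e \<times> 'v) chart set \<Rightarrow> ('f \<Rightarrow> 'm)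
   \<Rightarrow> ('f \<Rightarrow> 'f) \<Rightarrow> ('m \<Rightarrow> 'm)
   \<Rightarrow> ('m \<Rightarrow> ('f \<times> (('f, 'e \<times> 'v) chart \<Rightarrow> 'e \<times> 'v), 'k) kmod) \<Rightarrow> bool" where
  "invariant_connection sE sV B \<pi> f fM \<Gamma> \<longleftrightarrow>
     (\<forall>x. klinear (TF_fiber sE sV B \<pi> x) (\<Gamma> x) (TF_fiber sE sV B \<pi> (fM x)) (\<Gamma> (fM x))
        (\<lambda>(u, \<xi>). (f u, tangent_map (prod_scale sE sV) B (prod_scale sE sV) B f u \<xi>)))"

end

theory Submission
  imports Defs
begin

text \<open>
  In a bundle chart at \<open>x \<in> M\<close>, the symmetry \<open>\<sigma>\<^sub>x\<close> at the zero vector over \<open>x\<close> has the form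
  \<open>(y, u) \<mapsto> (s y, A y u)\<close> with \<open>A y\<close> linear, because \<open>\<mu>\<close> is linear on \<open>F\<^sub>p \<times> F\<^sub>q\<close>. As \<open>\<sigma>\<^sub>x\<close> is a
  symmetry of the symmetric space \<open>F\<close>, its tangent map at \<open>0\<^sub>x\<close> is \<open>-id\<close>; hence the differential of \<open>s\<close>
  at \<open>x\<close> and the map \<open>A x\<close> are both \<open>-id\<close>, and on the fiber \<open>V \<times> E \<times> V\<close> of \<open>TF \<rightarrow> M\<close> over \<open>x\<close>
    \<open>T\<sigma>\<^sub>x (u, v, z) = (-u, -v, \<beta>\<^sub>x(v, u) - z)\<close>
  with \<open>\<beta>\<^sub>x\<close> bilinear, namely the derivative of \<open>A\<close> in direction \<open>v\<close> (lemmas \<open>bundle_map_deriv\<close> and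
  \<open>chart_deriv_symmetry\<close>).

  Uniqueness (\<open>connection_unique\<close>): in the coordinates \<open>(u, v, w) = (u, v, z - b\<^sub>x(v, u))\<close> of a linear
  connection, the last component of \<open>T\<sigma>\<^sub>x\<close> is \<open>-w + (\<beta>\<^sub>x - 2 b\<^sub>x)(v, u)\<close>. A map \<open>(u, v) \<mapsto> q(v, u)\<close> which is
  both additive on the product and bilinear vanishes, so invariance under \<open>\<sigma>\<^sub>x\<close> forces
  \<open>b\<^sub>x = \<beta>\<^sub>x / 2\<close>.

  Existence: the formula \<open>b = \<beta> / 2\<close> is smooth in all variables, because \<open>\<beta>\<close> is obtained by inserting
  linear expressions into the differential of the smooth multiplication map of \<open>F\<close>
  (\<open>christoffel_smooth\<close>). It remains to see that the structures defined in different charts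
  agree, and that the resulting connection is invariant. Both are instances of one fact
  (\<open>TF_map_linear\<close>): if a bundle map \<open>f\<close> satisfies \<open>f \<circ> \<sigma>\<^sub>x = \<sigma>\<^sub>f\<^sub>x \<circ> f\<close>, then
  differentiating this identity shows that \<open>Tf\<close> is linear in the coordinates
  \<open>(u, v, z - \<beta>\<^sub>x(v, u) / 2)\<close>. The identity map yields the independence of charts, and
  \<open>\<sigma>\<^sub>p \<circ> \<sigma>\<^sub>x = \<sigma>\<^sub>\<sigma>\<^sub>p\<^sub>x \<circ> \<sigma>\<^sub>p\<close> yields the invariance.

  Over a topological ring, these arguments rest on an elementary calculus in which a limit for
  \<open>t \<rightarrow> 0\<close> is replaced by continuity of the difference quotient together with the density of the
  units: two continuous functions of \<open>t\<close> which agree at all units agree at \<open>0\<close>. The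
  geometry is expressed through first difference quotients; higher differentiability enters with the
  smoothness of \<open>b\<close>.
\<close>

section \<open>Modules with continuous operations\<close>

text \<open>Continuity of addition is stated as a property of the module, in the same way as that of scalar
  multiplication, so that both pass to products. Continuity of the negative follows from the multiplication by \<open>-1\<close>.\<close>

locale continuous_module = module scale
  for scale :: "'k::{comm_ring_1, topological_space}
    \<Rightarrow> 'e::{ab_group_add, topological_space} \<Rightarrow> 'e" +
  assumes continuous_on_scale_UNIV: "continuous_on UNIV (\<lambda>(r, x). scale r x)"
    and continuous_on_plus_UNIV: "continuous_on UNIV (\<lambda>(x::'e, y). x + y)"
begin

lemma continuous_on_scale:
  assumes "continuous_on S f" "continuous_on S g"
  shows "continuous_on S (\<lambda>x. scale (f x) (g x))"
proof -
  have "continuous_on S ((\<lambda>(r, x). scale r x) \<circ> (\<lambda>x. (f x, g x)))"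
    using assms continuous_on_scale_UNIV
    by (intro continuous_on_compose continuous_on_Pair) (auto intro: continuous_on_subset)
  then show ?thesis by (simp add: o_def)
qed

lemma continuous_on_plus:
  fixes f g :: "'x::topological_space \<Rightarrow> 'e"
  assumes "continuous_on S f" "continuous_on S g"
  shows "continuous_on S (\<lambda>x. f x + g x)"
proof -
  have "continuous_on S ((\<lambda>(x, y). x + y) \<circ> (\<lambda>x. (f x, g x)))"
    using assms continuous_on_plus_UNIV
    by (intro continuous_on_compose continuous_on_Pair) (auto intro: continuous_on_subset)
  then show ?thesis by (simp add: o_def)
qed

end

lemma continuous_module_of_topological_module:
  assumes "topological_module s"
  shows "continuous_module s"
proof -
  interpret topological_module s by fact
  show ?thesis
    using continuous_scale
    by unfold_locales (auto simp: case_prod_unfold intro!: continuous_intros)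
qed

lemma prod_scale_apply [simp]: "prod_scale s t r (x, y) = (s r x, t r y)"
  by (simp add: prod_scale_def)

lemma fst_prod_scale [simp]: "fst (prod_scale s t r p) = s r (fst p)"
  and snd_prod_scale [simp]: "snd (prod_scale s t r p) = t r (snd p)"
  by (simp_all add: prod_scale_def)

lemma continuous_module_prod:
  fixes s :: "'k::{comm_ring_1, topological_space} \<Rightarrow> 'a::{ab_group_add, topological_space} \<Rightarrow> 'a"
    and t :: "'k \<Rightarrow> 'b::{ab_group_add, topological_space} \<Rightarrow> 'b"
  assumes "continuous_module s" "continuous_module t"
  shows "continuous_module (prod_scale s t)"
proof -
  interpret s: continuous_module s by fact
  interpret t: continuous_module t by fact
  show ?thesis
  proof
    have "continuous_on UNIV (\<lambda>x. (s (fst x) (fst (snd x)), t (fst x) (snd (snd x))))"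
      by (intro continuous_on_Pair s.continuous_on_scale t.continuous_on_scale continuous_intros)
    then show "continuous_on UNIV (\<lambda>(r, x). prod_scale s t r x)"
      by (simp add: prod_scale_def case_prod_unfold map_prod_def)
    have "continuous_on UNIV (\<lambda>x::('a \<times> 'b) \<times> ('a \<times> 'b).
        (fst (fst x) + fst (snd x), snd (fst x) + snd (snd x)))"
      by (intro continuous_on_Pair s.continuous_on_plus t.continuous_on_plus continuous_intros)
    then show "continuous_on UNIV (\<lambda>(x::'a \<times> 'b, y). x + y)"
      by (simp add: plus_prod_def case_prod_unfold)
  qed (auto simp: prod_eq_iff s.scale_right_distrib t.scale_right_distrib
        s.scale_left_distrib t.scale_left_distrib)
qed

section \<open>Difference quotients of first order\<close>

text \<open>The first difference quotient \<open>f\<^sup>[\<^sup>1\<^sup>]\<close> lives here on a subset of the product \<open>E \<times> E \<times> K\<close>, where the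
  usual tools for continuity apply; the lemma \<open>diff_quot_level_0\<close> below translates from trees.\<close>

definition slope_dom :: "('k \<Rightarrow> 'e::plus \<Rightarrow> 'e) \<Rightarrow> 'e set \<Rightarrow> ('e \<times> 'e \<times> 'k) set" where
  "slope_dom s U = {(x, v, t). x \<in> U \<and> x + s t v \<in> U}"

definition has_slope ::
  "('k::topological_space \<Rightarrow> 'e::{topological_space, ab_group_add} \<Rightarrow> 'e)
   \<Rightarrow> ('k \<Rightarrow> 'f::{topological_space, ab_group_add} \<Rightarrow> 'f)
   \<Rightarrow> 'e set \<Rightarrow> ('e \<Rightarrow> 'f) \<Rightarrow> ('e \<times> 'e \<times> 'k \<Rightarrow> 'f) \<Rightarrow> bool" where
  "has_slope sE sF U f g \<longleftrightarrow> open U \<and> continuous_on (slope_dom sE U) g \<and>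
     (\<forall>x v t. (x, v, t) \<in> slope_dom sE U \<longrightarrow> f (x + sE t v) - f x = sF t (g (x, v, t)))"

lemma mem_slope_dom [simp]: "(x, v, t) \<in> slope_dom s U \<longleftrightarrow> x \<in> U \<and> x + s t v \<in> U"
  by (simp add: slope_dom_def)

lemma continuous_map_un_base: "continuous_map (pt_top 0) euclidean un_base"
  using continuous_map_pullback[of euclidean euclidean id "pts 0" un_base] by simp

lemma continuous_map_un_ext:
  "continuous_map (pt_top (Suc n)) (prod_topology (pt_top n) (prod_topology (pt_top n) euclidean)) un_ext"
  using continuous_map_pullback[of "prod_topology (pt_top n) (prod_topology (pt_top n) euclidean)"
      "prod_topology (pt_top n) (prod_topology (pt_top n) euclidean)" id "pts (Suc n)" un_ext]
  by simp

lemma topspace_pt_top [simp]: "topspace (pt_top n) = pts n"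
  by (induction n) (auto simp: topspace_pullback_topology)

lemma continuous_map_into_pt_top_0:
  assumes "continuous_map T euclidean f"
  shows "continuous_map T (pt_top 0) (\<lambda>x. Base (f x))"
  unfolding pt_top.simps
  by (rule continuous_map_pullback') (use assms in \<open>auto simp: o_def\<close>)

lemma continuous_map_into_pt_top_Suc:
  assumes "continuous_map T (pt_top n) p" "continuous_map T (pt_top n) v" "continuous_map T euclidean t"
  shows "continuous_map T (pt_top (Suc n)) (\<lambda>x. Ext (p x) (v x) (t x))"
  unfolding pt_top.simps
proof (rule continuous_map_pullback')
  show "continuous_map T (prod_topology (pt_top n) (prod_topology (pt_top n) euclidean))
     (un_ext \<circ> (\<lambda>x. Ext (p x) (v x) (t x)))"
    using assms by (auto simp: o_def continuous_map_pairwise)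
  show "topspace T \<subseteq> (\<lambda>x. Ext (p x) (v x) (t x)) -` pts (Suc n)"
    using continuous_map_image_subset_topspace[OF assms(1)]
      continuous_map_image_subset_topspace[OF assms(2)] by auto
qed

lemma continuous_map_un_ext_compose:
  assumes "continuous_map T (pt_top (Suc n)) f"
  shows "continuous_map T (pt_top n) (\<lambda>x. fst (un_ext (f x)))"
    and "continuous_map T (pt_top n) (\<lambda>x. fst (snd (un_ext (f x))))"
    and "continuous_map T euclidean (\<lambda>x. snd (snd (un_ext (f x))))"
  using continuous_map_compose[OF assms continuous_map_un_ext]
  by (auto simp: o_def continuous_map_pairwise)

text \<open>The tree \<open>Ext (Base x) (Base v) t\<close> depends homeomorphically on the triple \<open>(x, v, t)\<close>.\<close>

lemma diff_quot_level_0: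
  "diff_quot sE sF 0 (Base ` U) (f \<circ> un_base) g \<longleftrightarrow>
     continuous_on (slope_dom sE U) (\<lambda>(x, v, t). g (Ext (Base x) (Base v) t)) \<and>
     (\<forall>x v t. (x, v, t) \<in> slope_dom sE U \<longrightarrow>
        f (x + sE t v) - f x = sF t (g (Ext (Base x) (Base v) t)))"
proof -
  let ?D = "ext_dom sE 0 (Base ` U)"
  let ?h = "\<lambda>q. Ext (Base (fst q)) (Base (fst (snd q))) (snd (snd q))"
  let ?k = "\<lambda>q. (un_base (fst (un_ext q)), un_base (fst (snd (un_ext q))), snd (snd (un_ext q)))"
  have D: "?D = ?h ` slope_dom sE U"
    unfolding ext_dom_def slope_dom_def
    by (auto simp: image_iff)
  have kh: "?k (?h q) = q" for q by simp
  have h: "continuous_map (subtopology euclidean (slope_dom sE U)) (subtopology (pt_top (Suc 0)) ?D) ?h"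
    by (intro continuous_map_into_subtopology continuous_map_from_subtopology
        continuous_map_into_pt_top_Suc continuous_map_into_pt_top_0)
      (auto simp: D continuous_on_fst continuous_on_snd)
  have k: "continuous_map (subtopology (pt_top (Suc 0)) ?D) (subtopology euclidean (slope_dom sE U)) ?k"
  proof (intro continuous_map_into_subtopology continuous_map_from_subtopology)
    note c = continuous_map_un_ext_compose[OF continuous_map_id, of 0, unfolded id_def]
    have "continuous_map (pt_top (Suc 0)) (prod_topology euclidean (prod_topology euclidean euclidean)) ?k"
      using c(3) continuous_map_compose[OF c(1) continuous_map_un_base]
        continuous_map_compose[OF c(2) continuous_map_un_base]
      by (simp add: continuous_map_pairwise o_def del: pt_top.simps prod_topology_euclidean)
    then show "continuous_map (pt_top (Suc 0)) euclidean ?k"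
      by (simp only: prod_topology_euclidean)
  qed (auto simp: D)
  have "continuous_map (subtopology (pt_top (Suc 0)) ?D) euclidean g \<longleftrightarrow>
        continuous_map (subtopology euclidean (slope_dom sE U)) euclidean (g \<circ> ?h)"
  proof
    assume "continuous_map (subtopology euclidean (slope_dom sE U)) euclidean (g \<circ> ?h)"
    from continuous_map_compose[OF k this]
    show "continuous_map (subtopology (pt_top (Suc 0)) ?D) euclidean g"
      by (rule continuous_map_eq) (auto simp: D)
  qed (rule continuous_map_compose[OF h])
  moreover have "(\<forall>p v t. Ext p v t \<in> ?D \<longrightarrow>
        (f \<circ> un_base) (pt_add p (pt_scale sE t v)) - (f \<circ> un_base) p = sF t (g (Ext p v t))) \<longleftrightarrow>
     (\<forall>x v t. (x, v, t) \<in> slope_dom sE U \<longrightarrow>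
        f (x + sE t v) - f x = sF t (g (Ext (Base x) (Base v) t)))" (is "?L \<longleftrightarrow> ?R")
  proof
    assume L: ?L
    show ?R
    proof (intro allI impI)
      fix x v t assume "(x, v, t) \<in> slope_dom sE U"
      then show "f (x + sE t v) - f x = sF t (g (Ext (Base x) (Base v) t))"
        using L[rule_format, of "Base x" "Base v" t] by (simp add: ext_dom_def)
    qed
  qed (auto simp: ext_dom_def)
  ultimately show ?thesis
    unfolding diff_quot_def by (simp add: o_def case_prod_unfold del: pt_top.simps)
qed

lemma slope_dom_mono: "U' \<subseteq> U \<Longrightarrow> slope_dom s U' \<subseteq> slope_dom s U"
  by (auto simp: slope_dom_def)

lemma has_slope_subset:
  assumes "has_slope sE sF U f g" "open U'" "U' \<subseteq> U"
  shows "has_slope sE sF U' f g"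
  using assms slope_dom_mono[OF assms(3), of sE] unfolding has_slope_def
  by (meson continuous_on_subset subsetD)

lemma has_slope_cong:
  assumes "has_slope sE sF U f g" "\<And>x. x \<in> U \<Longrightarrow> f x = f' x"
  shows "has_slope sE sF U f' g"
  using assms unfolding has_slope_def by auto

text \<open>The chain rule in the form \<open>(g \<circ> f)\<^sup>[\<^sup>1\<^sup>](x, v, t) = g\<^sup>[\<^sup>1\<^sup>](f x, f\<^sup>[\<^sup>1\<^sup>](x, v, t), t)\<close>, which
  holds since \<open>f (x + t v) = f x + t f\<^sup>[\<^sup>1\<^sup>](x, v, t)\<close>.\<close>

lemma has_slope_compose:
  assumes f: "has_slope sE sF U f f1" and g: "has_slope sF sG V g g1"
    and W: "open W" "W \<subseteq> U" "f ` W \<subseteq> V"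
    and cf: "continuous_on W f"
  shows "has_slope sE sG W (g \<circ> f) (\<lambda>(x, v, t). g1 (f x, f1 (x, v, t), t))"
  unfolding has_slope_def
proof (intro conjI allI impI)
  have eq: "f (x + sE t v) = f x + sF t (f1 (x, v, t))" if "(x, v, t) \<in> slope_dom sE W" for x v t
  proof -
    have "f (x + sE t v) - f x = sF t (f1 (x, v, t))"
      using f slope_dom_mono[OF W(2), of sE] that unfolding has_slope_def by blast
    then show ?thesis by (simp add: algebra_simps)
  qed
  show "open W" by fact
  have f1: "continuous_on (slope_dom sE W) f1"
    using has_slope_subset[OF f W(1,2)] by (simp add: has_slope_def)
  have "continuous_on (slope_dom sE W) (g1 \<circ> (\<lambda>p. (f (fst p), f1 p, snd (snd p))))"
  proof (rule continuous_on_compose)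
    show "continuous_on (slope_dom sE W) (\<lambda>p. (f (fst p), f1 p, snd (snd p)))"
      by (intro continuous_on_Pair f1 continuous_on_compose2[OF cf] continuous_intros)
        (auto simp: slope_dom_def)
    have "(\<lambda>p. (f (fst p), f1 p, snd (snd p))) ` slope_dom sE W \<subseteq> slope_dom sF V"
      using W(3) by (auto simp: eq[symmetric] image_subset_iff)
    then show "continuous_on ((\<lambda>p. (f (fst p), f1 p, snd (snd p))) ` slope_dom sE W) g1"
      using g unfolding has_slope_def by (auto intro: continuous_on_subset)
  qed
  then show "continuous_on (slope_dom sE W) (\<lambda>(x, v, t). g1 (f x, f1 (x, v, t), t))"
    by (simp add: o_def case_prod_unfold)
  fix x v t assume *: "(x, v, t) \<in> slope_dom sE W"
  then have "(f x, f1 (x, v, t), t) \<in> slope_dom sF V"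
    using W(3) by (auto simp: eq[OF *, symmetric])
  then show "(g \<circ> f) (x + sE t v) - (g \<circ> f) x = sG t (case (x, v, t) of (x, v, t) \<Rightarrow> g1 (f x, f1 (x, v, t), t))"
    using g by (auto simp: has_slope_def eq[OF *])
qed

text \<open>Taking \<open>t = 1\<close> expresses \<open>f\<close> through its difference quotient at one fixed base point:
  \<open>f y = f x + f\<^sup>[\<^sup>1\<^sup>](x, y - x, 1)\<close>.\<close>

lemma has_slope_continuous_on:
  assumes E: "continuous_module sE" and F: "continuous_module sF" and f: "has_slope sE sF U f g"
  shows "continuous_on U f"
proof -
  interpret E: continuous_module sE by fact
  interpret F: continuous_module sF by fact
  have minus: "continuous_on S (\<lambda>y. y - x)" for S :: "'b set" and x
    using E.continuous_on_plus[of S "\<lambda>y. y" "\<lambda>y. - x"] by (simp add: continuous_on_id)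
  have "continuous_on U f" if x: "x \<in> U" for x
  proof -
    have "continuous_on U (g \<circ> (\<lambda>y. (x, y - x, 1)))"
    proof (rule continuous_on_compose)
      show "continuous_on U (\<lambda>y. (x, y - x, 1))"
        by (intro continuous_on_Pair minus continuous_intros)
      show "continuous_on ((\<lambda>y. (x, y - x, 1)) ` U) g"
        using f x unfolding has_slope_def by (auto elim!: continuous_on_subset)
    qed
    then have "continuous_on U (\<lambda>y. f x + (g \<circ> (\<lambda>y. (x, y - x, 1))) y)"
      by (rule F.continuous_on_plus[OF continuous_on_const])
    moreover have "f x + (g \<circ> (\<lambda>y. (x, y - x, 1))) y = f y" if "y \<in> U" for y
    proof -
      have "f (x + sE 1 (y - x)) - f x = sF 1 (g (x, y - x, 1))"
        using f[unfolded has_slope_def, THEN conjunct2, THEN conjunct2, rule_format, of x "y - x" 1] x that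
        by simp
      then show ?thesis by (simp add: algebra_simps)
    qed
    ultimately show "continuous_on U f" by (simp cong: continuous_on_cong)
  qed
  then show ?thesis
    by (cases "U = {}") auto
qed

lemma has_slope_affine:
  assumes E: "continuous_module sE" and F: "continuous_module sF"
    and l: "module_hom sE sF l" "continuous_on UNIV l"
  shows "has_slope sE sF UNIV (\<lambda>x. c + l x) (\<lambda>(x, v, t). l v)"
proof -
  interpret l: module_hom sE sF l by fact
  have "continuous_on S (\<lambda>p. l (fst (snd p)))" for S :: "('b \<times> 'b \<times> 'a) set"
    by (intro continuous_on_compose2[OF l(2)] continuous_intros) auto
  then show ?thesis
    by (simp add: has_slope_def case_prod_unfold l.add l.scale)
qed

section \<open>Differentials\<close>

text \<open>The neighborhood is quantified existentially, so that the predicate depends on the germ of \<open>f\<close>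
  at \<open>x\<close> only, and compositions of chart expressions need no bookkeeping of domains.\<close>

definition has_differential ::
  "('k::{topological_space, zero} \<Rightarrow> 'e::{topological_space, ab_group_add} \<Rightarrow> 'e)
   \<Rightarrow> ('k \<Rightarrow> 'f::{topological_space, ab_group_add} \<Rightarrow> 'f)
   \<Rightarrow> ('e \<Rightarrow> 'f) \<Rightarrow> 'e \<Rightarrow> ('e \<Rightarrow> 'f) \<Rightarrow> bool" where
  "has_differential sE sF f x f' \<longleftrightarrow>
     (\<exists>U g. x \<in> U \<and> has_slope sE sF U f g \<and> (\<forall>v. f' v = g (x, v, 0)))"

abbreviation dense_units :: "'k::{comm_ring_1, topological_space} itself \<Rightarrow> bool" where
  "dense_units K \<equiv> closure {r::'k. r dvd 1} = UNIV"

text \<open>The substitute for taking limits: the set where two continuous maps into a Hausdorff space differ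
  is open, hence contains a unit unless it is empty.\<close>

lemma eq_if_eq_on_units:
  fixes g h :: "'k::{comm_ring_1, topological_space} \<Rightarrow> 'f::t2_space"
  assumes "dense_units TYPE('k)" "open T" "continuous_on T g" "continuous_on T h"
    and eq: "\<And>t. t \<in> T \<Longrightarrow> t dvd 1 \<Longrightarrow> g t = h t" and "t \<in> T"
  shows "g t = h t"
proof (rule ccontr)
  assume ne: "g t \<noteq> h t"
  obtain A B where AB: "open A" "open B" "g t \<in> A" "h t \<in> B" "A \<inter> B = {}"
    using hausdorff[OF ne] by auto
  let ?S = "(T \<inter> g -` A) \<inter> (T \<inter> h -` B)"
  have "open (T \<inter> g -` A)" "open (T \<inter> h -` B)"
    by (rule continuous_open_preimage[OF assms(3) assms(2) AB(1)]
        continuous_open_preimage[OF assms(4) assms(2) AB(2)])+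
  then have "open ?S" by (rule open_Int)
  moreover have "t \<in> ?S" using AB \<open>t \<in> T\<close> by simp
  ultimately have "?S \<inter> {r. r dvd 1} \<noteq> {}"
    using open_Int_closure_eq_empty[of ?S "{r::'k. r dvd 1}"] assms(1) by blast
  then show False using eq AB by auto
qed

lemma scale_unit_cancel:
  assumes "module s" "r dvd 1" "s r x = s r y"
  shows "x = y"
proof -
  interpret module s by fact
  obtain q where "1 = r * q" using assms(2) by (auto elim: dvdE)
  then have "q * r = 1" by (simp add: mult.commute)
  then show ?thesis using assms(3) by (metis scale_one scale_scale)
qed

lemma open_line:
  assumes "continuous_module s" "open U"
  shows "open {t. x + s t v \<in> U}"
proof -
  interpret continuous_module s by fact
  have "continuous_on UNIV (\<lambda>t. x + s t v)"
    by (intro continuous_on_plus continuous_on_scale continuous_intros)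
  then show ?thesis using open_vimage[OF assms(2)] by (simp add: vimage_def)
qed

text \<open>A directional derivative may be computed from any continuous difference quotient \<open>h\<close> along the
  line, because at units \<open>t\<close> the value \<open>h t\<close> is determined by \<open>f\<close>.\<close>

lemma has_differential_directional:
  fixes sE :: "'k::{comm_ring_1, topological_space} \<Rightarrow> 'e::{ab_group_add, topological_space} \<Rightarrow> 'e"
    and sF :: "'k \<Rightarrow> 'f::{ab_group_add, t2_space} \<Rightarrow> 'f"
  assumes du: "dense_units TYPE('k)" and E: "continuous_module sE" and F: "continuous_module sF"
    and f: "has_differential sE sF f x f'"
    and T: "open T" "0 \<in> T" "continuous_on T h"
    and h: "\<And>t. t \<in> T \<Longrightarrow> f (x + sE t v) - f x = sF t (h t)"
  shows "f' v = h 0"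
proof -
  interpret E: continuous_module sE by fact
  interpret F: continuous_module sF by fact
  obtain U g where U: "x \<in> U" "has_slope sE sF U f g" "\<And>v. f' v = g (x, v, 0)"
    using f by (auto simp: has_differential_def)
  let ?T = "T \<inter> {t. x + sE t v \<in> U}"
  have "g (x, v, 0) = h 0"
  proof (rule eq_if_eq_on_units[OF du, of ?T "\<lambda>t. g (x, v, t)" h])
    show "open ?T" using T U open_line[OF E] by (auto simp: has_slope_def)
    show "continuous_on ?T (\<lambda>t. g (x, v, t))"
    proof (rule continuous_on_compose2[where g = g])
      show "continuous_on (slope_dom sE U) g" using U by (simp add: has_slope_def)
    qed (use U in \<open>auto intro!: continuous_intros\<close>)
    show "continuous_on ?T h" using T by (auto intro: continuous_on_subset)
    show "0 \<in> ?T" using T U by simp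
    fix t assume t: "t \<in> ?T" "t dvd 1"
    then have "sF t (g (x, v, t)) = sF t (h t)"
      using h[of t] U by (auto simp: has_slope_def)
    then show "g (x, v, t) = h t"
      using scale_unit_cancel[OF F.module_axioms t(2)] by blast
  qed
  then show ?thesis using U by simp
qed

lemma has_differential_unique:
  fixes sE :: "'k::{comm_ring_1, topological_space} \<Rightarrow> 'e::{ab_group_add, topological_space} \<Rightarrow> 'e"
    and sF :: "'k \<Rightarrow> 'f::{ab_group_add, t2_space} \<Rightarrow> 'f"
  assumes du: "dense_units TYPE('k)" and E: "continuous_module sE" and F: "continuous_module sF"
    and f: "has_differential sE sF f x f'" "has_differential sE sF f x f''"
  shows "f' = f''"
proof
  fix v
  interpret E: continuous_module sE by fact
  obtain U g where U: "x \<in> U" "has_slope sE sF U f g" "\<And>v. f'' v = g (x, v, 0)"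
    using f by (auto simp: has_differential_def)
  have "f' v = g (x, v, 0)"
  proof (rule has_differential_directional[OF du E F f(1), of "{t. x + sE t v \<in> U}"])
    show "open {t. x + sE t v \<in> U}" using U open_line[OF E] by (auto simp: has_slope_def)
    show "continuous_on {t. x + sE t v \<in> U} (\<lambda>t. g (x, v, t))"
    proof (rule continuous_on_compose2[where g = g])
      show "continuous_on (slope_dom sE U) g" using U by (simp add: has_slope_def)
    qed (use U in \<open>auto intro!: continuous_intros\<close>)
  qed (use U in \<open>auto simp: has_slope_def\<close>)
  then show "f' v = f'' v" using U by simp
qed

lemma has_differential_cong:
  assumes "has_differential sE sF f x f'" "open W" "x \<in> W" "\<And>y. y \<in> W \<Longrightarrow> f y = h y"
  shows "has_differential sE sF h x f'"
proof -
  obtain U g where U: "x \<in> U" "has_slope sE sF U f g" "\<And>v. f' v = g (x, v, 0)"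
    using assms by (auto simp: has_differential_def)
  have "open (U \<inter> W)" using U assms by (auto simp: has_slope_def)
  then have "has_slope sE sF (U \<inter> W) h g"
    using has_slope_cong[OF has_slope_subset[OF U(2)]] assms by blast
  then show ?thesis using U assms unfolding has_differential_def by blast
qed

lemma has_differential_compose:
  assumes E: "continuous_module sE" and F: "continuous_module sF"
    and f: "has_differential sE sF f x f'" and g: "has_differential sF sG g (f x) g'"
  shows "has_differential sE sG (g \<circ> f) x (g' \<circ> f')"
proof -
  obtain U f1 where U: "x \<in> U" "has_slope sE sF U f f1" "\<And>v. f' v = f1 (x, v, 0)"
    using f by (auto simp: has_differential_def)
  obtain V g1 where V: "f x \<in> V" "has_slope sF sG V g g1" "\<And>v. g' v = g1 (f x, v, 0)"
    using g by (auto simp: has_differential_def)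
  have cf: "continuous_on U f" by (rule has_slope_continuous_on[OF E F U(2)])
  have "open (U \<inter> f -` V)"
    using U V by (auto simp: has_slope_def intro: continuous_open_preimage[OF cf])
  then have "has_slope sE sG (U \<inter> f -` V) (g \<circ> f) (\<lambda>(x, v, t). g1 (f x, f1 (x, v, t), t))"
    by (intro has_slope_compose[OF U(2) V(2)] continuous_on_subset[OF cf]) auto
  then show ?thesis
    unfolding has_differential_def
    by (intro exI[of _ "U \<inter> f -` V"] exI[of _ "\<lambda>(x, v, t). g1 (f x, f1 (x, v, t), t)"]) (simp add: U V)
qed

lemma has_differential_affine:
  assumes "continuous_module sE" "continuous_module sF"
    and "module_hom sE sF l" "continuous_on UNIV l"
  shows "has_differential sE sF (\<lambda>x. c + l x) x l"
  using has_slope_affine[OF assms, of c] unfolding has_differential_def by force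

lemma has_differential_linear:
  assumes "continuous_module sE" "continuous_module sF"
    and "module_hom sE sF l" "continuous_on UNIV l"
  shows "has_differential sE sF l x l"
  using has_differential_affine[OF assms, of 0] by simp

text \<open>Additivity comes from the quotient \<open>f\<^sup>[\<^sup>1\<^sup>](x, v, t) + f\<^sup>[\<^sup>1\<^sup>](x + t v, w, t)\<close> in direction \<open>v + w\<close>,
  which splits the step \<open>t (v + w)\<close> into two; homogeneity from \<open>r f\<^sup>[\<^sup>1\<^sup>](x, v, r t)\<close> in direction
  \<open>r v\<close>.\<close>

lemma module_hom_has_differential:
  fixes sE :: "'k::{comm_ring_1, topological_space} \<Rightarrow> 'e::{ab_group_add, topological_space} \<Rightarrow> 'e"
    and sF :: "'k \<Rightarrow> 'f::{ab_group_add, t2_space} \<Rightarrow> 'f"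
  assumes du: "dense_units TYPE('k)" and K: "continuous_on UNIV (\<lambda>(r::'k, s). r * s)"
    and E: "continuous_module sE" and F: "continuous_module sF"
    and f: "has_differential sE sF f x f'"
  shows "module_hom sE sF f'"
proof -
  interpret E: continuous_module sE by fact
  interpret F: continuous_module sF by fact
  obtain U g where U: "x \<in> U" "has_slope sE sF U f g" "\<And>v. f' v = g (x, v, 0)"
    using f by (auto simp: has_differential_def)
  then have oU: "open U" and cg: "continuous_on (slope_dom sE U) g" by (auto simp: has_slope_def)
  have slope: "f (x + sE t v) = f x + sF t (g (x, v, t))" if "x \<in> U" "x + sE t v \<in> U" for x v t
    using U that by (simp add: has_slope_def algebra_simps)
  show ?thesis
  proof unfold_locales
    fix v w
    let ?T = "{t. x + sE t v \<in> U} \<inter> {t. x + sE t (v + w) \<in> U}"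
    have "f' (v + w) = (\<lambda>t. g (x, v, t) + g (x + sE t v, w, t)) 0"
    proof (rule has_differential_directional[OF du E F f])
      show "open ?T" using open_line[OF E oU] by blast
      show "continuous_on ?T (\<lambda>t. g (x, v, t) + g (x + sE t v, w, t))"
        by (intro F.continuous_on_plus continuous_on_compose2[OF cg] continuous_intros
            E.continuous_on_plus E.continuous_on_scale)
          (auto simp: U algebra_simps)
      fix t assume t: "t \<in> ?T"
      then show "f (x + sE t (v + w)) - f x = sF t (g (x, v, t) + g (x + sE t v, w, t))"
        using slope[of x t v] slope[of "x + sE t v" t w] U
        by (simp add: algebra_simps)
    qed (use U in simp)
    then show "f' (v + w) = f' v + f' w" by (simp add: U)
  next
    fix r v
    have rt: "continuous_on S (\<lambda>t::'k. r * t)" for S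
      using continuous_on_compose2[OF K, of S "\<lambda>t. (r, t)"] by (simp add: continuous_intros)
    have "f' (sE r v) = (\<lambda>t. sF r (g (x, v, r * t))) 0"
    proof (rule has_differential_directional[OF du E F f])
      show "open {t. x + sE t (sE r v) \<in> U}" by (rule open_line[OF E oU])
      show "continuous_on {t. x + sE t (sE r v) \<in> U} (\<lambda>t. sF r (g (x, v, r * t)))"
        by (intro F.continuous_on_scale continuous_on_compose2[OF cg] continuous_intros rt)
          (auto simp: U mult.commute)
      fix t assume "t \<in> {t. x + sE t (sE r v) \<in> U}"
      then show "f (x + sE t (sE r v)) - f x = sF t (sF r (g (x, v, r * t)))"
        using slope[of x "r * t" v] U by (simp add: mult.commute)
    qed (use U in simp)
    then show "f' (sE r v) = sF r (f' v)" by (simp add: U)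
  qed
qed

lemma has_slope_imp_has_differential:
  assumes "has_slope sE sF U f g" "x \<in> U"
  shows "has_differential sE sF f x (\<lambda>v. g (x, v, 0))"
  using assms by (auto simp: has_differential_def)

text \<open>By uniqueness of the difference quotient at \<open>t = 0\<close>, the description in the definition of the
  differential has exactly one solution.\<close>

lemma has_differential_differential:
  fixes sE :: "'k::{comm_ring_1, topological_space} \<Rightarrow> 'e::{ab_group_add, topological_space} \<Rightarrow> 'e"
    and sF :: "'k \<Rightarrow> 'f::{ab_group_add, t2_space} \<Rightarrow> 'f"
  assumes du: "dense_units TYPE('k)" and E: "continuous_module sE" and F: "continuous_module sF"
    and f: "has_slope sE sF U f g" and x: "x \<in> U"
  shows "has_differential sE sF f x (differential sE sF U f x)"
proof -
  let ?g = "\<lambda>p. g (un_base (fst (un_ext p)), un_base (fst (snd (un_ext p))), snd (snd (un_ext p)))"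
  have "differential sE sF U f x v = g (x, v, 0)" for v
    unfolding differential_def
  proof (rule the_equality)
    show "\<exists>h. diff_quot sE sF 0 (Base ` U) (f \<circ> un_base) h \<and> g (x, v, 0) = h (Ext (Base x) (Base v) 0)"
      using f by (intro exI[of _ ?g]) (simp add: diff_quot_level_0 has_slope_def)
  next
    fix w assume "\<exists>h. diff_quot sE sF 0 (Base ` U) (f \<circ> un_base) h \<and> w = h (Ext (Base x) (Base v) 0)"
    then obtain h where h: "diff_quot sE sF 0 (Base ` U) (f \<circ> un_base) h" "w = h (Ext (Base x) (Base v) 0)"
      by blast
    then have "has_slope sE sF U f (\<lambda>(x, v, t). h (Ext (Base x) (Base v) t))"
      using f by (auto simp: diff_quot_level_0 has_slope_def)
    from has_differential_unique[OF du E F has_slope_imp_has_differential[OF this x]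
        has_slope_imp_has_differential[OF f x]]
    show "w = g (x, v, 0)" using h by (auto dest: fun_cong)
  qed
  then have "differential sE sF U f x = (\<lambda>v. g (x, v, 0))" by blast
  then show ?thesis using has_slope_imp_has_differential[OF f x] by simp
qed

lemma smooth_on_imp_has_slope:
  assumes "smooth_on sE sF U f"
  obtains g where "has_slope sE sF U f g"
proof -
  have U: "open U" and "Ck sE sF (Suc 0) 0 (Base ` U) (f \<circ> un_base)"
    using assms unfolding smooth_on_def by blast+
  then obtain h where "diff_quot sE sF 0 (Base ` U) (f \<circ> un_base) h" by auto
  then have "has_slope sE sF U f (\<lambda>(x, v, t). h (Ext (Base x) (Base v) t))"
    using U by (auto simp: diff_quot_level_0 has_slope_def)
  then show thesis by (rule that)
qed

section \<open>Smoothness of compositions with linear maps\<close>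

text \<open>Composing with a linear map \<open>L\<close> commutes with forming difference quotients,
  \<open>(f \<circ> L)\<^sup>[\<^sup>1\<^sup>] = f\<^sup>[\<^sup>1\<^sup>] \<circ> (L \<times> L \<times> id)\<close>, and \<open>L \<times> L \<times> id\<close> is linear again; this gives
  smoothness of \<open>f \<circ> L\<close> by induction, without a chain rule of higher order. The induction requires
  maps between trees of arbitrary levels. The arguments of \<open>f\<close> which occur are of the form
  \<open>p + t v\<close>, so linearity is stated for these combinations.\<close>

definition pt_linear ::
  "('k::{topological_space, comm_ring_1} \<Rightarrow> 'e::{topological_space, ab_group_add} \<Rightarrow> 'e) \<Rightarrow> nat
   \<Rightarrow> ('k \<Rightarrow> 'f::{topological_space, ab_group_add} \<Rightarrow> 'f) \<Rightarrow> nat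
   \<Rightarrow> (('e, 'k) pt \<Rightarrow> ('f, 'k) pt) \<Rightarrow> bool" where
  "pt_linear sE m sF n L \<longleftrightarrow> continuous_map (pt_top m) (pt_top n) L \<and>
     (\<forall>p\<in>pts m. \<forall>v\<in>pts m. \<forall>t. L (pt_add p (pt_scale sE t v)) = pt_add (L p) (pt_scale sF t (L v)))"

text \<open>The map \<open>L \<times> L \<times> id\<close> between the modules of the next level.\<close>

definition ext_map :: "(('e, 'k) pt \<Rightarrow> ('f, 'k) pt) \<Rightarrow> ('e, 'k) pt \<Rightarrow> ('f, 'k) pt" where
  "ext_map L q = Ext (L (fst (un_ext q))) (L (fst (snd (un_ext q)))) (snd (snd (un_ext q)))"

lemma ext_map_Ext [simp]: "ext_map L (Ext p v t) = Ext (L p) (L v) t"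
  by (simp add: ext_map_def)

lemma pt_linear_pts: "pt_linear sE m sF n L \<Longrightarrow> p \<in> pts m \<Longrightarrow> L p \<in> pts n"
  by (simp add: pt_linear_def continuous_map_def Pi_iff)

lemma pt_linear_ext_map:
  fixes L :: "('e::{topological_space, ab_group_add}, 'k::{topological_space, comm_ring_1}) pt
    \<Rightarrow> ('f::{topological_space, ab_group_add}, 'k) pt"
  assumes "pt_linear sE m sF n L"
  shows "pt_linear sE (Suc m) sF (Suc n) (ext_map L)"
  unfolding pt_linear_def
proof (intro conjI ballI allI)
  note c = continuous_map_un_ext_compose[OF continuous_map_id, unfolded id_def]
  have L: "continuous_map (pt_top m) (pt_top n) L" using assms by (simp add: pt_linear_def)
  have "continuous_map (pt_top (Suc m)) (pt_top (Suc n))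
     (\<lambda>q. Ext (L (fst (un_ext q))) (L (fst (snd (un_ext q)))) (snd (snd (un_ext q))))"
    by (intro continuous_map_into_pt_top_Suc c(3) continuous_map_compose[OF c(1) L, unfolded o_def]
        continuous_map_compose[OF c(2) L, unfolded o_def])
  then show "continuous_map (pt_top (Suc m)) (pt_top (Suc n)) (ext_map L)"
    by (simp add: ext_map_def[abs_def] del: pt_top.simps)
  fix p v :: "('e, 'k) pt" and t assume "p \<in> pts (Suc m)" "v \<in> pts (Suc m)"
  then show "ext_map L (pt_add p (pt_scale sE t v)) = pt_add (ext_map L p) (pt_scale sF t (ext_map L v))"
    using assms by (auto simp: pt_linear_def)
qed

lemma ext_dom_subset: "D \<subseteq> pts n \<Longrightarrow> ext_dom s n D \<subseteq> pts (Suc n)"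
  by (auto simp: ext_dom_def)

lemma Ck_compose_pt_linear:
  assumes "pt_linear sE m sF n L" "D' \<subseteq> pts m" "L ` D' \<subseteq> D" "Ck sF sG k n D f"
  shows "Ck sE sG k m D' (f \<circ> L)"
  using assms
proof (induction k arbitrary: m n L D D' f)
  case 0
  have "continuous_map (subtopology (pt_top m) D') (subtopology (pt_top n) D) L"
    using 0 by (intro continuous_map_into_subtopology continuous_map_from_subtopology)
      (auto simp: pt_linear_def image_subset_iff)
  then show ?case using 0 continuous_map_compose[of _ _ L euclidean f] by (simp add: o_def)
next
  case (Suc k)
  obtain g where g: "diff_quot sF sG n D f g" "Ck sF sG k (Suc n) (ext_dom sF n D) g"
    using Suc.prems by auto
  have L: "pt_linear sE (Suc m) sF (Suc n) (ext_map L)"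
    using Suc.prems by (simp add: pt_linear_ext_map)
  have lin: "L (pt_add p (pt_scale sE t v)) = pt_add (L p) (pt_scale sF t (L v))"
    if "p \<in> D'" "v \<in> pts m" for p v t
    using Suc.prems that by (auto simp: pt_linear_def)
  have im: "ext_map L ` ext_dom sE m D' \<subseteq> ext_dom sF n D"
  proof
    fix q assume "q \<in> ext_map L ` ext_dom sE m D'"
    then obtain p v t where q: "q = Ext (L p) (L v) t" "p \<in> D'" "v \<in> pts m"
      "pt_add p (pt_scale sE t v) \<in> D'"
      by (auto simp: ext_dom_def)
    then show "q \<in> ext_dom sF n D"
      using Suc.prems(3) pt_linear_pts[OF Suc.prems(1)] lin[of p v t, symmetric]
      by (auto simp: ext_dom_def)
  qed
  have cont: "continuous_map (subtopology (pt_top (Suc m)) (ext_dom sE m D'))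
      (subtopology (pt_top (Suc n)) (ext_dom sF n D)) (ext_map L)"
    using L im
    by (intro continuous_map_into_subtopology continuous_map_from_subtopology)
      (auto simp: pt_linear_def simp del: pt_top.simps)
  have "diff_quot sE sG m D' (f \<circ> L) (g \<circ> ext_map L)"
    unfolding diff_quot_def
  proof (intro conjI allI impI)
    show "continuous_map (subtopology (pt_top (Suc m)) (ext_dom sE m D')) euclidean (g \<circ> ext_map L)"
      using g(1) unfolding diff_quot_def by (intro continuous_map_compose[OF cont]) blast
    fix p v t assume q: "Ext p v t \<in> ext_dom sE m D'"
    then have "ext_map L (Ext p v t) \<in> ext_dom sF n D" using im by blast
    moreover have "p \<in> D'" "v \<in> pts m" using q by (auto simp: ext_dom_def)
    ultimately show "(f \<circ> L) (pt_add p (pt_scale sE t v)) - (f \<circ> L) p = sG t ((g \<circ> ext_map L) (Ext p v t))"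
      using g(1) by (simp add: diff_quot_def lin)
  qed
  moreover have "Ck sE sG k (Suc m) (ext_dom sE m D') (g \<circ> ext_map L)"
    using Suc.IH[OF L ext_dom_subset[OF Suc.prems(2)] im g(2)] .
  ultimately show ?case unfolding Ck.simps by blast
qed

lemma Ck_linear_compose:
  assumes l: "module_hom sF sG l" "continuous_on UNIV l" and "Ck sE sF k n D f"
  shows "Ck sE sG k n D (l \<circ> f)"
  using assms(3)
proof (induction k arbitrary: n D f)
  case 0
  then show ?case
    using continuous_map_compose[of _ euclidean f euclidean l] l(2) by (simp add: o_def)
next
  case (Suc k)
  interpret module_hom sF sG l by fact
  obtain g where g: "diff_quot sE sF n D f g" "Ck sE sF k (Suc n) (ext_dom sE n D) g"
    using Suc.prems by auto
  have "diff_quot sE sG n D (l \<circ> f) (l \<circ> g)"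
    unfolding diff_quot_def
  proof (intro conjI allI impI)
    show "continuous_map (subtopology (pt_top (Suc n)) (ext_dom sE n D)) euclidean (l \<circ> g)"
      using g(1) l unfolding diff_quot_def by (intro continuous_map_compose[of _ euclidean]) auto
    fix p v t assume "Ext p v t \<in> ext_dom sE n D"
    then have "f (pt_add p (pt_scale sE t v)) - f p = sF t (g (Ext p v t))"
      using g(1) by (auto simp: diff_quot_def)
    from arg_cong[OF this, of l]
    show "(l \<circ> f) (pt_add p (pt_scale sE t v)) - (l \<circ> f) p = sG t ((l \<circ> g) (Ext p v t))"
      by (simp add: diff scale)
  qed
  moreover have "Ck sE sG k (Suc n) (ext_dom sE n D) (l \<circ> g)"
    by (rule Suc.IH[OF g(2)])
  ultimately show ?case unfolding Ck.simps by blast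
qed

lemma Ck_cong:
  assumes "Ck sE sF k n D f" "\<And>p. p \<in> D \<Longrightarrow> f p = f' p"
  shows "Ck sE sF k n D f'"
proof (cases k)
  case 0
  then show ?thesis using assms by (auto intro: continuous_map_eq)
next
  case (Suc k')
  have "diff_quot sE sF n D f' g" if "diff_quot sE sF n D f g" for g
    using that assms(2) by (auto simp: diff_quot_def ext_dom_def)
  then show ?thesis using assms(1) Suc by auto
qed

text \<open>The assignment \<open>w \<mapsto> df(l\<^sub>1 w)(l\<^sub>2 w)\<close> is \<open>f\<^sup>[\<^sup>1\<^sup>]\<close> composed with the linear map
  \<open>w \<mapsto> (l\<^sub>1 w, l\<^sub>2 w, 0)\<close> into level one. The difference quotient witnessing the class \<open>C\<^sup>k\<^sup>+\<^sup>1\<close> may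
  change with \<open>k\<close>, but its values at \<open>t = 0\<close> do not.\<close>

lemma smooth_on_differential_along_linear:
  fixes sE :: "'k::{comm_ring_1, topological_space} \<Rightarrow> 'e::{ab_group_add, topological_space} \<Rightarrow> 'e"
    and sF :: "'k \<Rightarrow> 'f::{ab_group_add, t2_space} \<Rightarrow> 'f"
  assumes du: "dense_units TYPE('k)" and E: "continuous_module sE" and F: "continuous_module sF"
    and f: "smooth_on sE sF U f"
    and l1: "module_hom sG sE l1" "continuous_on UNIV l1"
    and l2: "module_hom sG sE l2" "continuous_on UNIV l2"
    and h: "module_hom sF sH h" "continuous_on UNIV h"
    and W: "open W" "\<And>w. w \<in> W \<Longrightarrow> l1 w \<in> U"
  shows "smooth_on sG sH W (\<lambda>w. h (differential sE sF U f (l1 w) (l2 w)))"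
  unfolding smooth_on_def
proof (intro conjI allI)
  interpret E: continuous_module sE by fact
  interpret l1: module_hom sG sE l1 by fact
  interpret l2: module_hom sG sE l2 by fact
  show "open W" by fact
  fix k
  let ?L = "\<lambda>q. Ext (Base (l1 (un_base q))) (Base (l2 (un_base q))) 0"
  have "Ck sE sF (Suc k) 0 (Base ` U) (f \<circ> un_base)"
    using f unfolding smooth_on_def by blast
  then obtain g where g: "diff_quot sE sF 0 (Base ` U) (f \<circ> un_base) g"
    "Ck sE sF k (Suc 0) (ext_dom sE 0 (Base ` U)) g"
    by auto
  have "open U" using f by (simp add: smooth_on_def)
  with g(1) have slope: "has_slope sE sF U f (\<lambda>(x, v, t). g (Ext (Base x) (Base v) t))"
    by (auto simp: diff_quot_level_0 has_slope_def)
  have g0: "differential sE sF U f x v = g (Ext (Base x) (Base v) 0)" if "x \<in> U" for x v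
    using fun_cong[OF has_differential_unique[OF du E F
        has_differential_differential[OF du E F slope that]
        has_slope_imp_has_differential[OF slope that]], of v]
    by simp
  have "pt_linear sG 0 sE (Suc 0) ?L"
    unfolding pt_linear_def
  proof (intro conjI ballI allI)
    have "continuous_map (pt_top 0) euclidean (\<lambda>q. l1 (un_base q))"
      "continuous_map (pt_top 0) euclidean (\<lambda>q. l2 (un_base q))"
      by (rule continuous_map_compose[OF continuous_map_un_base, unfolded o_def], simp add: l1 l2)+
    then show "continuous_map (pt_top 0) (pt_top (Suc 0)) ?L"
      by (intro continuous_map_into_pt_top_Suc continuous_map_into_pt_top_0) auto
  qed (auto simp: l1.add l2.add l1.scale l2.scale)
  moreover have "?L ` (Base ` W) \<subseteq> ext_dom sE 0 (Base ` U)"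
    using W by (auto simp: ext_dom_def)
  ultimately have "Ck sG sF k 0 (Base ` W) (g \<circ> ?L)"
    by (intro Ck_compose_pt_linear[OF _ _ _ g(2)]) auto
  from Ck_linear_compose[OF h this]
  show "Ck sG sH k 0 (Base ` W) ((\<lambda>w. h (differential sE sF U f (l1 w) (l2 w))) \<circ> un_base)"
    by (rule Ck_cong) (auto simp: g0 W)
qed

section \<open>Tangent maps of self-maps of a manifold\<close>

lemma chart_inv_chart: "is_chart c \<Longrightarrow> p \<in> fst c \<Longrightarrow> chart_inv c (snd c p) = p"
  by (auto simp: is_chart_def homeomorphism_def)

lemma inj_on_chart: "is_chart c \<Longrightarrow> inj_on (snd c) (fst c)"
  by (metis chart_inv_chart inj_onI)

lemma chart_inv_pair:
  assumes "is_chart c" "is_chart d" "p \<in> fst c" "q \<in> fst d"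
  shows "chart_inv (fst c \<times> fst d, map_prod (snd c) (snd d)) (snd c p, snd d q) = (p, q)"
proof -
  have "inj_on (map_prod (snd c) (snd d)) (fst c \<times> fst d)"
    by (intro map_prod_inj_on inj_on_chart assms)
  then have "inv_into (fst c \<times> fst d) (map_prod (snd c) (snd d)) (map_prod (snd c) (snd d) (p, q)) = (p, q)"
    by (rule inv_into_f_f) (simp add: assms)
  then show ?thesis by (simp add: chart_inv_def)
qed

lemma loc_map_apply: "is_chart c \<Longrightarrow> p \<in> fst c \<Longrightarrow> loc_map c f d (snd c p) = snd d (f p)"
  by (simp add: loc_map_def chart_inv_chart)

lemma mem_loc_dom: "p \<in> fst c \<Longrightarrow> f p \<in> fst d \<Longrightarrow> snd c p \<in> loc_dom c f d"
  by (auto simp: loc_dom_def)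

lemma open_loc_dom:
  assumes "is_chart c" "is_chart d" "continuous_on UNIV f"
  shows "open (loc_dom c f d)"
proof -
  have h: "homeomorphism (fst c) (snd c ` fst c) (snd c) (chart_inv c)"
    and o: "open (fst c)" "open (snd c ` fst c)" "open (fst d)"
    using assms by (auto simp: is_chart_def)
  have "open (fst c \<inter> f -` fst d)"
    using o assms(3) by (intro open_Int open_vimage)
  then have "openin (top_of_set (snd c ` fst c)) (snd c ` (fst c \<inter> f -` fst d))"
    using o by (intro homeomorphism_imp_open_map[OF h]) (auto simp: openin_open_eq)
  then show ?thesis using o by (simp add: loc_dom_def openin_open_eq)
qed

text \<open>Self-maps suffice, as the bundle maps of interest are the identity and the symmetries of one and
  the same total space.\<close>

locale manifold = continuous_module s
  for s :: "'k::{comm_ring_1, topological_space} \<Rightarrow> 'e::{ab_group_add, t2_space} \<Rightarrow> 'e" +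
  fixes A :: "('m::topological_space, 'e) chart set"
  assumes dense_units: "dense_units TYPE('k)"
    and continuous_on_mult: "continuous_on UNIV (\<lambda>(r::'k, t). r * t)"
    and atlas: "is_atlas s A"
begin

definition C1_map :: "('m \<Rightarrow> 'm) \<Rightarrow> bool" where
  "C1_map f \<longleftrightarrow> (\<forall>c\<in>A. \<forall>d\<in>A. \<exists>g. has_slope s s (loc_dom c f d) (loc_map c f d) g)"

definition chart_deriv :: "('m, 'e) chart \<Rightarrow> ('m \<Rightarrow> 'm) \<Rightarrow> ('m, 'e) chart \<Rightarrow> 'm \<Rightarrow> 'e \<Rightarrow> 'e" where
  "chart_deriv c f d p = differential s s (loc_dom c f d) (loc_map c f d) (snd c p)"

lemma is_chart: "c \<in> charts_at A p \<Longrightarrow> is_chart c"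
  using atlas by (auto simp: is_atlas_def charts_at_def)

lemma charts_atD: "c \<in> charts_at A p \<Longrightarrow> c \<in> A" "c \<in> charts_at A p \<Longrightarrow> p \<in> fst c"
  by (auto simp: charts_at_def)

lemma charts_at_nonempty: "\<exists>c. c \<in> charts_at A p"
proof -
  have "p \<in> (\<Union>c\<in>A. fst c)" using atlas by (simp add: is_atlas_def)
  then show ?thesis by (auto simp: charts_at_def)
qed

lemma C1_map_id: "C1_map id"
  unfolding C1_map_def
proof (intro ballI)
  fix c d assume "c \<in> A" "d \<in> A"
  then have "smooth_on s s (loc_dom c id d) (loc_map c id d)"
    using atlas by (simp add: is_atlas_def)
  then show "\<exists>g. has_slope s s (loc_dom c id d) (loc_map c id d) g"
    by (rule smooth_on_imp_has_slope) blast
qed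

lemma chart_deriv_has_differential:
  assumes "C1_map f" "c \<in> charts_at A p" "d \<in> charts_at A (f p)"
  shows "has_differential s s (loc_map c f d) (snd c p) (chart_deriv c f d p)"
proof -
  obtain g where "has_slope s s (loc_dom c f d) (loc_map c f d) g"
    using assms(1) charts_atD(1)[OF assms(2)] charts_atD(1)[OF assms(3)] unfolding C1_map_def by blast
  then show ?thesis
    unfolding chart_deriv_def
    by (rule has_differential_differential[OF dense_units continuous_module_axioms continuous_module_axioms])
      (use assms in \<open>auto intro: mem_loc_dom charts_atD\<close>)
qed

lemma chart_deriv_eqI:
  assumes "C1_map f" "c \<in> charts_at A p" "d \<in> charts_at A (f p)"
    and "has_differential s s (loc_map c f d) (snd c p) f'"
  shows "chart_deriv c f d p = f'"
  by (rule has_differential_unique[OF dense_units continuous_module_axioms continuous_module_axioms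
        chart_deriv_has_differential[OF assms(1-3)] assms(4)])

lemma chart_deriv_chain:
  assumes f: "C1_map f" and g: "C1_map g"
    and c: "c \<in> charts_at A p" "d \<in> charts_at A (f p)" "e \<in> charts_at A (g (f p))"
  shows "has_differential s s (loc_map c (g \<circ> f) e) (snd c p)
    (chart_deriv d g e (f p) \<circ> chart_deriv c f d p)"
proof (rule has_differential_cong)
  have fp: "loc_map c f d (snd c p) = snd d (f p)"
    using c by (simp add: loc_map_apply is_chart charts_atD)
  show "has_differential s s (loc_map d g e \<circ> loc_map c f d) (snd c p)
    (chart_deriv d g e (f p) \<circ> chart_deriv c f d p)"
    by (rule has_differential_compose[OF continuous_module_axioms continuous_module_axioms
          chart_deriv_has_differential[OF f c(1,2)]])
      (simp add: fp chart_deriv_has_differential[OF g c(2,3)])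
  show "open (loc_dom c f d)"
    using f c charts_atD by (auto simp: C1_map_def has_slope_def)
  show "snd c p \<in> loc_dom c f d"
    using c by (intro mem_loc_dom charts_atD)
  fix y assume "y \<in> loc_dom c f d"
  then obtain q where "y = snd c q" "q \<in> fst c" "f q \<in> fst d" by (auto simp: loc_dom_def)
  then show "(loc_map d g e \<circ> loc_map c f d) y = loc_map c (g \<circ> f) e y"
    using c by (simp add: loc_map_apply is_chart)
qed

lemma chart_deriv_compose:
  assumes "C1_map f" "C1_map g" "C1_map (g \<circ> f)"
    and "c \<in> charts_at A p" "d \<in> charts_at A (f p)" "e \<in> charts_at A (g (f p))"
  shows "chart_deriv c (g \<circ> f) e p w = chart_deriv d g e (f p) (chart_deriv c f d p w)"
  using chart_deriv_eqI[OF assms(3,4) _ chart_deriv_chain[OF assms(1,2,4-6)]] assms(6)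
  by simp

text \<open>Both sides are the differential of the common composition at the same point, in charts which may
  pass through different intermediate points.\<close>

lemma chart_deriv_commute:
  assumes "C1_map f" "C1_map g" "C1_map f'" "C1_map g'" and eq: "g \<circ> f = g' \<circ> f'"
    and c: "c \<in> charts_at A p" "d \<in> charts_at A (f p)" "d' \<in> charts_at A (f' p)"
      "e \<in> charts_at A (g (f p))"
  shows "chart_deriv d g e (f p) (chart_deriv c f d p w) =
    chart_deriv d' g' e (f' p) (chart_deriv c f' d' p w)"
proof -
  have "g (f p) = g' (f' p)" using fun_cong[OF eq] by simp
  then show ?thesis
    using has_differential_unique[OF dense_units continuous_module_axioms continuous_module_axioms
      chart_deriv_chain[OF assms(1,2) c(1,2,4)]
      chart_deriv_chain[OF assms(3,4) c(1,3), of e, folded eq]] c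
    by (auto dest: fun_cong)
qed

lemma chart_deriv_id:
  assumes "c \<in> charts_at A p"
  shows "chart_deriv c id c p w = w"
proof -
  have "has_differential s s (loc_map c id c) (snd c p) id"
  proof (rule has_differential_cong)
    show "has_differential s s id (snd c p) id"
      by (rule has_differential_linear[OF continuous_module_axioms continuous_module_axioms])
        (auto simp: module_hom_iff module_axioms continuous_on_id)
    show "open (snd c ` fst c)" "snd c p \<in> snd c ` fst c"
      using is_chart[OF assms] charts_atD[OF assms] by (auto simp: is_chart_def)
    fix y assume "y \<in> snd c ` fst c"
    then show "id y = loc_map c id c y"
      using is_chart[OF assms] by (auto simp: loc_map_apply)
  qed
  from chart_deriv_eqI[OF C1_map_id assms _ this] show ?thesis using assms by simp
qed

lemma tangent_space_iff:
  "\<xi> \<in> tangent_space s A p \<longleftrightarrow>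
    (\<forall>c\<in>charts_at A p. \<forall>d\<in>charts_at A p. \<xi> d = chart_deriv c id d p (\<xi> c)) \<and>
    (\<forall>c. c \<notin> charts_at A p \<longrightarrow> \<xi> c = 0)"
  by (simp add: tangent_space_def chart_deriv_def)

lemma tangent_vector_chart:
  assumes "\<xi> \<in> tangent_space s A p" "c \<in> charts_at A p" "d \<in> charts_at A p"
  shows "\<xi> d = chart_deriv c id d p (\<xi> c)"
  using assms unfolding tangent_space_iff by blast

lemma tangent_vector_eqI:
  assumes "\<xi> \<in> tangent_space s A p" "\<eta> \<in> tangent_space s A p" "c \<in> charts_at A p" "\<xi> c = \<eta> c"
  shows "\<xi> = \<eta>"
proof
  fix d show "\<xi> d = \<eta> d"
  proof (cases "d \<in> charts_at A p")
    case True
    show ?thesis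
      unfolding tangent_vector_chart[OF assms(1,3) True] tangent_vector_chart[OF assms(2,3) True]
      by (simp only: assms(4))
  next
    case False
    then have "\<xi> d = 0" "\<eta> d = 0" using assms(1,2) unfolding tangent_space_iff by blast+
    then show ?thesis by simp
  qed
qed

text \<open>Tangent vectors have arbitrary coordinates in a given chart; the compatibility of the remaining
  coordinates is the cocycle rule for the differentials of the transition maps.\<close>

lemma tangent_vector_exists:
  assumes "c \<in> charts_at A p"
  obtains \<xi> where "\<xi> \<in> tangent_space s A p" "\<xi> c = w"
proof -
  let ?\<xi> = "\<lambda>d. if d \<in> charts_at A p then chart_deriv c id d p w else 0"
  have "?\<xi> c = w" using assms by (simp add: chart_deriv_id)
  moreover have "chart_deriv d id e p (chart_deriv c id d p w) = chart_deriv c id e p w"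
    if "d \<in> charts_at A p" "e \<in> charts_at A p" for d e
    using chart_deriv_compose[OF C1_map_id C1_map_id, of c p d e w] that assms C1_map_id by simp
  then have "?\<xi> \<in> tangent_space s A p" by (simp add: tangent_space_iff)
  ultimately show thesis using that by blast
qed

text \<open>The chart selected in the definition of the tangent map may be exchanged for any other one, as a
  tangent vector transforms by the differential of the transition map.\<close>

lemma tangent_map_chart:
  assumes f: "C1_map f" and \<xi>: "\<xi> \<in> tangent_space s A p"
    and c: "c \<in> charts_at A p" "d \<in> charts_at A (f p)"
  shows "tangent_map s A s A f p \<xi> d = chart_deriv c f d p (\<xi> c)"
proof -
  define e where "e = (SOME c. c \<in> charts_at A p)"
  have e: "e \<in> charts_at A p" unfolding e_def using c(1) by (rule someI)
  have "tangent_map s A s A f p \<xi> d = chart_deriv e f d p (\<xi> e)"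
    using c by (simp add: tangent_map_def e_def[symmetric] chart_deriv_def)
  also have "\<xi> e = chart_deriv c id e p (\<xi> c)"
    by (rule tangent_vector_chart[OF \<xi> c(1) e])
  also have "chart_deriv e f d p \<dots> = chart_deriv c f d p (\<xi> c)"
    using chart_deriv_compose[OF C1_map_id f, of c p e d] f c e by simp
  finally show ?thesis .
qed

lemma tangent_map_mem:
  assumes f: "C1_map f" and \<xi>: "\<xi> \<in> tangent_space s A p"
  shows "tangent_map s A s A f p \<xi> \<in> tangent_space s A (f p)"
proof -
  obtain c where c: "c \<in> charts_at A p" using charts_at_nonempty by blast
  have "chart_deriv d id e (f p) (chart_deriv c f d p (\<xi> c)) = chart_deriv c f e p (\<xi> c)"
    if "d \<in> charts_at A (f p)" "e \<in> charts_at A (f p)" for d e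
    using chart_deriv_compose[OF f C1_map_id, of c p d e "\<xi> c"] f that c by simp
  then show ?thesis
    unfolding tangent_space_iff
    by (simp add: tangent_map_chart[OF f \<xi> c]) (simp add: tangent_map_def)
qed

lemma tangent_map_id:
  assumes "\<xi> \<in> tangent_space s A p"
  shows "tangent_map s A s A id p \<xi> = \<xi>"
proof -
  obtain c where c: "c \<in> charts_at A p" using charts_at_nonempty by blast
  show ?thesis
    using tangent_vector_eqI[OF _ assms c] tangent_map_mem[OF C1_map_id assms]
      tangent_map_chart[OF C1_map_id assms c, of c] c
    by (simp add: chart_deriv_id)
qed

lemma chart_deriv_eq_minus:
  assumes f: "C1_map f" "f p = p" and c: "c \<in> charts_at A p"
    and m: "\<And>\<xi>. \<xi> \<in> tangent_space s A p \<Longrightarrow> tangent_map s A s A f p \<xi> = (\<lambda>c. - \<xi> c)"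
  shows "chart_deriv c f c p w = - w"
proof -
  obtain \<xi> where \<xi>: "\<xi> \<in> tangent_space s A p" "\<xi> c = w" using tangent_vector_exists[OF c] .
  show ?thesis
    using tangent_map_chart[OF f(1) \<xi>(1) c, of c] m[OF \<xi>(1)] f(2) c \<xi>(2) by simp
qed

end

section \<open>Differentials of maps which are linear in the fibers\<close>

text \<open>For \<open>\<phi> (y, w) = (s y, A y w)\<close>, this is the product rule
  \<open>d\<phi>(a, w)(v, z) = (ds(a) v, (dA(a) v) w + A a z)\<close>. As no topology on linear maps is at hand
  in which to differentiate \<open>A\<close>, the term \<open>N v w\<close> stands for the partial derivative of \<open>A y w\<close> in \<open>y\<close> at fixed \<open>w\<close>,
  and its linearity in \<open>w\<close> is inherited from the difference quotients. The domain contains whole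
  fibers, which makes difference quotients at different \<open>w\<close> comparable at the same times \<open>t\<close>.\<close>

lemma differential_linear_in_fibers:
  fixes sE :: "'k::{comm_ring_1, topological_space} \<Rightarrow> 'e::{ab_group_add, t2_space} \<Rightarrow> 'e"
    and sV :: "'k \<Rightarrow> 'v::{ab_group_add, t2_space} \<Rightarrow> 'v"
  assumes du: "dense_units TYPE('k)" and K: "continuous_on UNIV (\<lambda>(r::'k, s). r * s)"
    and E: "continuous_module sE" and V: "continuous_module sV"
    and \<phi>: "has_slope (prod_scale sE sV) (prod_scale sE sV) \<Omega> \<phi> g"
    and \<Omega>: "\<And>y w w'. (y, w) \<in> \<Omega> \<Longrightarrow> (y, w') \<in> \<Omega>"
    and base: "\<And>y w w'. (y, w) \<in> \<Omega> \<Longrightarrow> fst (\<phi> (y, w)) = fst (\<phi> (y, w'))"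
    and add: "\<And>y w w'. (y, w) \<in> \<Omega> \<Longrightarrow> snd (\<phi> (y, w + w')) = snd (\<phi> (y, w)) + snd (\<phi> (y, w'))"
    and scale: "\<And>y w r. (y, w) \<in> \<Omega> \<Longrightarrow> snd (\<phi> (y, sV r w)) = sV r (snd (\<phi> (y, w)))"
    and a: "(a, w0) \<in> \<Omega>"
  obtains \<tau> N where "module_hom sE sE \<tau>" "\<And>w. module_hom sE sV (\<lambda>v. N v w)"
    "\<And>v. module_hom sV sV (\<lambda>w. N v w)"
    "\<And>w v z \<phi>'. has_differential (prod_scale sE sV) (prod_scale sE sV) \<phi> (a, w) \<phi>' \<Longrightarrow>
       \<phi>' (v, z) = (\<tau> v, N v w + snd (\<phi> (a, z)))"
proof -
  interpret E: continuous_module sE by fact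
  interpret V: continuous_module sV by fact
  let ?s = "prod_scale sE sV"
  interpret EV: continuous_module ?s by (rule continuous_module_prod[OF E V])
  have cm: "continuous_module ?s" ..
  have \<Omega>a: "(a, w) \<in> \<Omega>" for w using \<Omega>[OF a] .
  have oO: "open \<Omega>" and cg: "continuous_on (slope_dom ?s \<Omega>) g" using \<phi> by (auto simp: has_slope_def)
  let ?D = "\<lambda>w v. g ((a, w), v, 0)"
  have hd: "has_differential ?s ?s \<phi> (a, w) (?D w)" for w
    by (rule has_slope_imp_has_differential[OF \<phi> \<Omega>a])
  interpret D: module_hom ?s ?s "?D w" for w
    by (rule module_hom_has_differential[OF du K cm cm hd])
  have hfst: "module_hom ?s sE fst" and hsnd: "module_hom ?s sV snd"
    by (simp_all add: module_hom_iff E.module_axioms V.module_axioms EV.module_axioms)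
  have fst: "has_differential ?s sE (fst \<circ> \<phi>) (a, w) (fst \<circ> ?D w)" for w
    by (rule has_differential_compose[OF cm cm hd has_differential_linear[OF cm E hfst]])
      (simp add: continuous_on_fst)
  have snd: "has_differential ?s sV (snd \<circ> \<phi>) (a, w) (snd \<circ> ?D w)" for w
    by (rule has_differential_compose[OF cm cm hd has_differential_linear[OF cm V hsnd]])
      (simp add: continuous_on_snd)
  \<comment> \<open>times at which a line in base direction stays in the domain, independently of the fiber component\<close>
  let ?T = "\<lambda>v. {t. (a, 0) + ?s t (v, 0) \<in> \<Omega>}"
  have oT: "open (?T v)" for v by (rule open_line[OF cm oO])
  have T0: "0 \<in> ?T v" for v using \<Omega>a by (simp add: zero_prod_def[symmetric])
  have T: "(a + sE t v, w) \<in> \<Omega>" if "t \<in> ?T v" for t v w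
    using that \<Omega>[of "a + sE t v"] by simp
  have cgT: "continuous_on (?T v) (\<lambda>t. g ((a, w), (v, 0), t))" for v w
    by (intro continuous_on_compose2[OF cg] continuous_intros) (use T \<Omega>a in auto)
  have slope: "\<phi> (a + sE t v, w) - \<phi> (a, w) = ?s t (g ((a, w), (v, 0), t))" if "t \<in> ?T v" for t v w
    using \<phi>[unfolded has_slope_def, THEN conjunct2, THEN conjunct2, rule_format, of "(a, w)" "(v, 0)" t]
      T[OF that] \<Omega>a by simp
  define \<tau> where "\<tau> v = fst (?D 0 (v, 0))" for v
  define N where "N v w = snd (?D w (v, 0))" for v w
  have vertical: "?D w (0, z) = (0, snd (\<phi> (a, z)))" for w z
  proof (rule has_differential_directional[OF du cm cm hd, of UNIV])
    fix t
    show "\<phi> ((a, w) + ?s t (0, z)) - \<phi> (a, w) = ?s t (0, snd (\<phi> (a, z)))"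
      using base[OF \<Omega>a[of w], of "w + sV t z"] add[OF \<Omega>a[of w], of "sV t z"] scale[OF \<Omega>a[of z], of t]
      by (simp add: prod_eq_iff)
  qed auto
  have horizontal: "fst (?D w (v, 0)) = \<tau> v" for w v
  proof -
    have "(fst \<circ> ?D w) (v, 0) = fst (g ((a, 0), (v, 0), 0))"
    proof (rule has_differential_directional[OF du cm E fst oT[of v] T0])
      show "continuous_on (?T v) (\<lambda>t. fst (g ((a, 0), (v, 0), t)))"
        by (intro continuous_intros cgT)
      fix t assume t: "t \<in> ?T v"
      show "(fst \<circ> \<phi>) ((a, w) + ?s t (v, 0)) - (fst \<circ> \<phi>) (a, w) = sE t (fst (g ((a, 0), (v, 0), t)))"
        using slope[OF t, of 0] base[OF T[OF t], of w 0] base[OF \<Omega>a, of w 0]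
        by (simp add: prod_eq_iff)
    qed
    then show ?thesis by (simp add: \<tau>_def)
  qed
  have split: "?D w (v, z) = (\<tau> v, N v w + snd (\<phi> (a, z)))" for w v z
    using D.add[of w "(v, 0)" "(0, z)"] vertical[of w z] horizontal[of w v]
    by (simp add: prod_eq_iff N_def)
  have \<tau>: "module_hom sE sE \<tau>"
    using D.add[of 0 "(_, 0)" "(_, 0)"] D.scale[of 0 _ "(_, 0)"]
    by (simp add: module_hom_iff E.module_axioms \<tau>_def)
  have N1: "module_hom sE sV (\<lambda>v. N v w)" for w
    using D.add[of w "(_, 0)" "(_, 0)"] D.scale[of w _ "(_, 0)"]
    by (simp add: module_hom_iff E.module_axioms V.module_axioms N_def)
  have N2: "module_hom sV sV (\<lambda>w. N v w)" for v
  proof -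
    have "(snd \<circ> ?D (w + w')) (v, 0) = snd (g ((a, w), (v, 0), 0)) + snd (g ((a, w'), (v, 0), 0))" for w w'
    proof (rule has_differential_directional[OF du cm V snd oT[of v] T0])
      show "continuous_on (?T v) (\<lambda>t. snd (g ((a, w), (v, 0), t)) + snd (g ((a, w'), (v, 0), t)))"
        by (intro V.continuous_on_plus continuous_on_snd cgT)
      fix t assume t: "t \<in> ?T v"
      show "(snd \<circ> \<phi>) ((a, w + w') + ?s t (v, 0)) - (snd \<circ> \<phi>) (a, w + w') =
          sV t (snd (g ((a, w), (v, 0), t)) + snd (g ((a, w'), (v, 0), t)))"
        using slope[OF t, of w] slope[OF t, of w'] add[OF T[OF t], of w w'] add[OF \<Omega>a, of w w']
        by (simp add: prod_eq_iff V.scale_right_distrib[symmetric] flip: ) (simp add: algebra_simps)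
    qed
    moreover have "(snd \<circ> ?D (sV r w)) (v, 0) = sV r (snd (g ((a, w), (v, 0), 0)))" for r w
    proof (rule has_differential_directional[OF du cm V snd oT[of v] T0])
      show "continuous_on (?T v) (\<lambda>t. sV r (snd (g ((a, w), (v, 0), t))))"
        by (intro V.continuous_on_scale continuous_on_const continuous_on_snd cgT)
      fix t assume t: "t \<in> ?T v"
      show "(snd \<circ> \<phi>) ((a, sV r w) + ?s t (v, 0)) - (snd \<circ> \<phi>) (a, sV r w) =
          sV t (sV r (snd (g ((a, w), (v, 0), t))))"
        using arg_cong[OF slope[OF t, of w], of "\<lambda>p. sV r (snd p)"] scale[OF T[OF t], of r w]
          scale[OF \<Omega>a, of r w]
        by (simp add: V.scale_right_diff_distrib mult.commute)
    qed
    ultimately show ?thesis by (simp add: module_hom_iff V.module_axioms N_def)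
  qed
  show thesis
  proof (rule that[OF \<tau> N1 N2])
    fix w v z \<phi>' assume "has_differential ?s ?s \<phi> (a, w) \<phi>'"
    then have "\<phi>' = ?D w" by (rule has_differential_unique[OF du cm cm _ hd])
    then show "\<phi>' (v, z) = (\<tau> v, N v w + snd (\<phi> (a, z)))" by (simp add: split)
  qed
qed

section \<open>Transport of module structures\<close>

text \<open>The default values follow the normalization \<open>module_extensional\<close>, so that the structure is the
  only normalized one for which \<open>\<Psi>\<close> is linear.\<close>

definition transport_module :: "'a set \<Rightarrow> ('k \<Rightarrow> 'w \<Rightarrow> 'w::ab_group_add) \<Rightarrow> ('a \<Rightarrow> 'w) \<Rightarrow> ('a, 'k) kmod" where
  "transport_module S s \<Psi> =
     \<lparr>kadd = (\<lambda>x y. if x \<in> S \<and> y \<in> S then inv_into S \<Psi> (\<Psi> x + \<Psi> y) else undefined),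
      kzero = inv_into S \<Psi> 0,
      kscale = (\<lambda>r x. if x \<in> S then inv_into S \<Psi> (s r (\<Psi> x)) else undefined)\<rparr>"

lemma sum_module_type_module:
  "sum_module (type_module s) (type_module t) = type_module (prod_scale s t)"
  by (simp add: sum_module_def type_module_def fun_eq_iff plus_prod_def zero_prod_def prod_scale_def
      case_prod_unfold map_prod_def)

lemma transport_module:
  assumes s: "module s" and \<Psi>: "bij_betw \<Psi> S UNIV"
  shows "module_structure S (transport_module S s \<Psi>)"
    and "module_extensional S (transport_module S s \<Psi>)"
    and "kiso S (transport_module S s \<Psi>) UNIV (type_module s) \<Psi>"
proof -
  interpret module s by fact
  have inS [simp]: "inv_into S \<Psi> w \<in> S" for w
    using \<Psi> by (auto simp: bij_betw_def intro: inv_into_into)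
  have [simp]: "\<Psi> (inv_into S \<Psi> w) = w" for w
    using \<Psi> by (auto simp: bij_betw_def intro: f_inv_into_f)
  have [simp]: "inv_into S \<Psi> (\<Psi> x) = x" if "x \<in> S" for x
    using \<Psi> that by (auto simp: bij_betw_def intro: inv_into_f_f)
  have "\<exists>y\<in>S. inv_into S \<Psi> (\<Psi> x + \<Psi> y) = inv_into S \<Psi> 0" for x
    by (rule bexI[of _ "inv_into S \<Psi> (- \<Psi> x)"]) simp_all
  then show "module_structure S (transport_module S s \<Psi>)"
    by (simp add: module_structure_def transport_module_def add_ac scale_right_distrib scale_left_distrib)
  show "module_extensional S (transport_module S s \<Psi>)"
    by (auto simp: module_extensional_def transport_module_def)
  show "kiso S (transport_module S s \<Psi>) UNIV (type_module s) \<Psi>"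
    using \<Psi> by (simp add: kiso_def klinear_def transport_module_def type_module_def)
qed

lemma module_structureD:
  assumes X: "module_structure S X"
  shows "kzero X \<in> S"
    and "x \<in> S \<Longrightarrow> y \<in> S \<Longrightarrow> kadd X x y \<in> S"
    and "x \<in> S \<Longrightarrow> kscale X r x \<in> S"
    and "x \<in> S \<Longrightarrow> y \<in> S \<Longrightarrow> z \<in> S \<Longrightarrow> kadd X (kadd X x y) z = kadd X x (kadd X y z)"
    and "x \<in> S \<Longrightarrow> y \<in> S \<Longrightarrow> kadd X x y = kadd X y x"
    and "x \<in> S \<Longrightarrow> kadd X (kzero X) x = x"
    and "x \<in> S \<Longrightarrow> \<exists>y\<in>S. kadd X x y = kzero X"
proof -
  have assoc: "\<forall>x\<in>S. \<forall>y\<in>S. \<forall>z\<in>S. kadd X (kadd X x y) z = kadd X x (kadd X y z)"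
    and comm: "\<forall>x\<in>S. \<forall>y\<in>S. kadd X x y = kadd X y x"
    and zero: "\<forall>x\<in>S. kadd X (kzero X) x = x"
    and neg: "\<forall>x\<in>S. \<exists>y\<in>S. kadd X x y = kzero X"
    using X unfolding module_structure_def by - (elim conjE, assumption)+
  show "x \<in> S \<Longrightarrow> y \<in> S \<Longrightarrow> z \<in> S \<Longrightarrow> kadd X (kadd X x y) z = kadd X x (kadd X y z)"
    using assoc by simp
  show "x \<in> S \<Longrightarrow> y \<in> S \<Longrightarrow> kadd X x y = kadd X y x"
    using comm by blast
  show "x \<in> S \<Longrightarrow> kadd X (kzero X) x = x"
    using zero by simp
  show "x \<in> S \<Longrightarrow> \<exists>y\<in>S. kadd X x y = kzero X"
    using neg by (rule bspec)
qed (use X in \<open>simp_all add: module_structure_def\<close>)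

lemma klinear_zero:
  assumes X: "module_structure S X" and Y: "module_structure T Y" and f: "klinear S X T Y f"
  shows "f (kzero X) = kzero Y"
proof -
  note X = module_structureD[OF X] and Y = module_structureD[OF Y]
  let ?w = "f (kzero X)"
  have w: "?w \<in> T" using f X(1) by (auto simp: klinear_def)
  have "kadd Y ?w ?w = f (kadd X (kzero X) (kzero X))" using f X(1) by (simp add: klinear_def)
  then have ww: "kadd Y ?w ?w = ?w" by (simp add: X)
  obtain y where y: "y \<in> T" "kadd Y ?w y = kzero Y" using Y(7)[OF w] by blast
  have "kzero Y = kadd Y (kadd Y ?w ?w) y" by (simp add: ww y)
  also have "\<dots> = kadd Y ?w (kzero Y)" by (simp add: Y(4) w y)
  also have "\<dots> = kadd Y (kzero Y) ?w" by (rule Y(5)[OF w Y(1)])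
  also have "\<dots> = ?w" by (rule Y(6)[OF w])
  finally show ?thesis by simp
qed

lemma module_structure_type_module: "module s \<Longrightarrow> module_structure UNIV (type_module s)"
  unfolding module_structure_def type_module_def
  by (auto simp: module_def add_ac intro!: exI[of _ "- _"])

text \<open>A normalized structure is determined by a linear bijection onto a known module. This reduces the
  uniqueness of the connection to the uniqueness of its coordinates.\<close>

lemma kiso_eq_transport_module:
  assumes s: "module s" and Y: "module_structure S Y" "module_extensional S Y"
    and \<Psi>: "kiso S Y UNIV (type_module s) \<Psi>"
  shows "Y = transport_module S s \<Psi>"
proof -
  have inv: "inv_into S \<Psi> (\<Psi> x) = x" if "x \<in> S" for x
    using \<Psi> that by (auto simp: kiso_def bij_betw_def intro: inv_into_f_f)
  have lin: "\<Psi> (kadd Y x y) = \<Psi> x + \<Psi> y" "\<Psi> (kscale Y r x) = s r (\<Psi> x)" if "x \<in> S" "y \<in> S" for x y r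
    using \<Psi> that by (auto simp: kiso_def klinear_def type_module_def)
  have mem: "kadd Y x y \<in> S" "kscale Y r x \<in> S" "kzero Y \<in> S" if "x \<in> S" "y \<in> S" for x y r
    using Y that by (auto simp: module_structure_def)
  have zero: "\<Psi> (kzero Y) = 0" "kzero Y \<in> S"
    using klinear_zero[OF Y(1) module_structure_type_module[OF s]] \<Psi> Y(1)
    by (auto simp: kiso_def type_module_def module_structure_def)
  have "kadd Y = kadd (transport_module S s \<Psi>)"
  proof (intro ext)
    fix x y show "kadd Y x y = kadd (transport_module S s \<Psi>) x y"
    proof (cases "x \<in> S \<and> y \<in> S")
      case True
      then show ?thesis
        using inv[OF mem(1)[of x y]] by (simp add: transport_module_def lin)
    next
      case False
      then show ?thesis using Y(2) by (auto simp: transport_module_def module_extensional_def)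
    qed
  qed
  moreover have "kscale Y = kscale (transport_module S s \<Psi>)"
  proof (intro ext)
    fix r x show "kscale Y r x = kscale (transport_module S s \<Psi>) r x"
    proof (cases "x \<in> S")
      case True
      then show ?thesis
        using inv[OF mem(2)[of x x r]] by (simp add: transport_module_def lin)
    next
      case False
      then show ?thesis using Y(2) by (simp add: transport_module_def module_extensional_def)
    qed
  qed
  moreover have "kzero Y = kzero (transport_module S s \<Psi>)"
    using inv[OF zero(2)] zero(1) by (simp add: transport_module_def)
  ultimately show ?thesis by simp
qed

lemma kiso_compose:
  assumes "kiso S X UNIV (type_module s) \<Psi>" "module_hom s t L"
    and "bij_betw \<Psi>' S UNIV" "\<And>x. x \<in> S \<Longrightarrow> \<Psi>' x = L (\<Psi> x)" "module_structure S X"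
  shows "kiso S X UNIV (type_module t) \<Psi>'"
proof -
  interpret module_hom s t L by fact
  show ?thesis
    using assms(1,3,5) assms(4)
    by (auto simp: kiso_def klinear_def type_module_def module_structure_def add scale)
qed

lemma klinear_in_coordinates:
  assumes X: "kiso S X UNIV (type_module s) \<Psi>" and Y: "kiso T Y UNIV (type_module t) \<Psi>'"
    and XY: "module_structure S X" "module_structure T Y"
    and f: "f \<in> S \<rightarrow> T" and L: "module_hom s t L" "\<And>x. x \<in> S \<Longrightarrow> \<Psi>' (f x) = L (\<Psi> x)"
  shows "klinear S X T Y f"
proof -
  interpret module_hom s t L by fact
  have inj: "x = y" if "x \<in> T" "y \<in> T" "\<Psi>' x = \<Psi>' y" for x y
    using Y that by (auto simp: kiso_def bij_betw_def inj_on_def)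
  have f': "f x \<in> T" if "x \<in> S" for x using f that by blast
  have X': "\<Psi> (kadd X x y) = \<Psi> x + \<Psi> y" "kadd X x y \<in> S" if "x \<in> S" "y \<in> S" for x y
    using X XY that by (auto simp: kiso_def klinear_def type_module_def module_structure_def)
  have X'': "\<Psi> (kscale X r x) = s r (\<Psi> x)" "kscale X r x \<in> S" if "x \<in> S" for x r
    using X XY that by (auto simp: kiso_def klinear_def type_module_def module_structure_def)
  have Y': "\<Psi>' (kadd Y x y) = \<Psi>' x + \<Psi>' y" "kadd Y x y \<in> T" if "x \<in> T" "y \<in> T" for x y
    using Y XY that by (auto simp: kiso_def klinear_def type_module_def module_structure_def)
  have Y'': "\<Psi>' (kscale Y r x) = t r (\<Psi>' x)" "kscale Y r x \<in> T" if "x \<in> T" for x r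
    using Y XY that by (auto simp: kiso_def klinear_def type_module_def module_structure_def)
  show ?thesis
    unfolding klinear_def
    by (intro conjI ballI allI f inj) (simp_all add: X' X'' Y' Y'' L f' add scale)
qed

section \<open>Symmetric bundles in bundle charts\<close>

locale symmetric_bundle_setting =
  fixes sE :: "'k::{comm_ring_1, topological_ab_group_add, topological_semigroup_mult}
      \<Rightarrow> 'e::{topological_ab_group_add, t2_space} \<Rightarrow> 'e"
    and sV :: "'k \<Rightarrow> 'v::{topological_ab_group_add, t2_space} \<Rightarrow> 'v"
    and A :: "('m::topological_space, 'e) chart set"
    and B :: "('f::topological_space, 'e \<times> 'v) chart set"
    and \<pi> :: "'f \<Rightarrow> 'm"
    and X :: "'m \<Rightarrow> ('f, 'k) kmod"
    and \<mu>M :: "'m \<Rightarrow> 'm \<Rightarrow> 'm"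
    and \<mu> :: "'f \<Rightarrow> 'f \<Rightarrow> 'f"
  assumes units: "dense_units TYPE('k)"
    and two_invertible: "(2::'k) dvd 1"
    and topological_module_E: "topological_module sE"
    and topological_module_V: "topological_module sV"
    and symmetric_bundle: "symmetric_bundle sE sV A B \<pi> X \<mu>M \<mu>"
begin

abbreviation "sF \<equiv> prod_scale sE sV"

definition half :: 'k where "half = (SOME h. 2 * h = 1)"

abbreviation zero_section :: "'m \<Rightarrow> 'f" where "zero_section x \<equiv> kzero (X x)"

abbreviation symmetry :: "'m \<Rightarrow> 'f \<Rightarrow> 'f" where "symmetry x \<equiv> \<mu> (zero_section x)"

abbreviation fib :: "('f, 'e \<times> 'v) chart \<Rightarrow> 'f \<Rightarrow> 'v" where "fib C u \<equiv> snd (snd C u)"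

lemma two_half: "2 * half = 1"
proof -
  obtain h :: 'k where "1 = 2 * h" using two_invertible by (rule dvdE)
  then have "\<exists>h::'k. 2 * h = 1" by (intro exI[of _ h]) simp
  then show ?thesis unfolding half_def by (rule someI_ex)
qed

lemma half_plus_half: "half + half = 1"
  by (simp only: mult_2[symmetric] two_half)

lemma continuous_module_E: "continuous_module sE"
  and continuous_module_V: "continuous_module sV"
  using topological_module_E topological_module_V
  by (auto intro: continuous_module_of_topological_module)

sublocale E: continuous_module sE by (rule continuous_module_E)
sublocale V: continuous_module sV by (rule continuous_module_V)

sublocale F: manifold sF B
proof -
  have "continuous_on UNIV (\<lambda>p::'k \<times> 'k. fst p * snd p)" by (intro continuous_intros)
  then show "manifold sF B"
    using symmetric_bundle units continuous_module_prod[OF continuous_module_E continuous_module_V]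
    by (simp add: manifold_def manifold_axioms_def case_prod_unfold symmetric_bundle_def vector_bundle_def)
qed

lemma structure_fiber: "module_structure (fiber \<pi> x) (X x)"
  using symmetric_bundle by (simp add: symmetric_bundle_def vector_bundle_def)

lemma zero_section_mem: "zero_section x \<in> fiber \<pi> x"
  using module_structureD(1)[OF structure_fiber] .

lemma bundle_chartE:
  assumes "C \<in> B" obtains c where "bundle_chart sV \<pi> X c C"
  using symmetric_bundle assms by (auto simp: symmetric_bundle_def vector_bundle_def)

text \<open>Bundle charts are defined on full preimages, so a chart at one point of a fiber is a chart at all
  of them. Throughout, the charts at a fiber are referred to as the charts at its zero vector.\<close>

lemma charts_at_fiber:
  assumes "u \<in> fiber \<pi> x"
  shows "charts_at B u = charts_at B (zero_section x)"
proof -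
  have "u \<in> fst C \<longleftrightarrow> zero_section x \<in> fst C" if C: "C \<in> B" for C
  proof -
    obtain c where "bundle_chart sV \<pi> X c C" using bundle_chartE[OF C] .
    then show ?thesis
      using assms zero_section_mem[of x] by (simp add: bundle_chart_def fiber_def)
  qed
  then show ?thesis by (auto simp: charts_at_def)
qed

lemma
  assumes C: "C \<in> charts_at B (zero_section x)"
  shows chart_over_mem: "u \<in> fiber \<pi> x \<Longrightarrow> u \<in> fst C"
    and chart_over_base: "u \<in> fiber \<pi> x \<Longrightarrow> fst (snd C u) = fst (snd C (zero_section x))"
    and chart_over_kiso: "kiso (fiber \<pi> x) (X x) UNIV (type_module sV) (fib C)"
proof -
  have CB: "C \<in> B" and z: "zero_section x \<in> fst C" using C by (auto simp: charts_at_def)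
  obtain c where c: "bundle_chart sV \<pi> X c C" using bundle_chartE[OF CB] .
  have p: "\<pi> (zero_section x) = x" using zero_section_mem[of x] by (simp add: fiber_def)
  have x: "x \<in> fst c" using c z p by (auto simp: bundle_chart_def)
  show mem: "u \<in> fst C" if "u \<in> fiber \<pi> x" for u
    using that c x by (auto simp: bundle_chart_def fiber_def)
  show "fst (snd C u) = fst (snd C (zero_section x))" if "u \<in> fiber \<pi> x"
  proof -
    have "\<pi> u = x" using that by (simp add: fiber_def)
    then show ?thesis using mem[OF that] c z p by (simp add: bundle_chart_def)
  qed
  show "kiso (fiber \<pi> x) (X x) UNIV (type_module sV) (fib C)"
    using c x by (simp add: bundle_chart_def)
qed

lemma fib_linear:
  assumes "C \<in> charts_at B (zero_section x)" "u \<in> fiber \<pi> x"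
  shows "u' \<in> fiber \<pi> x \<Longrightarrow> fib C (kadd (X x) u u') = fib C u + fib C u'"
    and "fib C (kscale (X x) r u) = sV r (fib C u)"
  using chart_over_kiso[OF assms(1)] assms(2) by (auto simp: kiso_def klinear_def type_module_def)

lemma fib_zero:
  assumes "C \<in> charts_at B (zero_section x)"
  shows "fib C (zero_section x) = 0"
  using klinear_zero[OF structure_fiber module_structure_type_module[OF V.module_axioms]]
    chart_over_kiso[OF assms] by (auto simp: kiso_def type_module_def)

lemma fiber_point:
  assumes "C \<in> charts_at B (zero_section x)"
  obtains u where "u \<in> fiber \<pi> x" "fib C u = w"
proof -
  have "w \<in> fib C ` fiber \<pi> x"
    using chart_over_kiso[OF assms] by (simp add: kiso_def bij_betw_def)
  then show thesis using that by blast
qed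

lemma fib_inj:
  assumes "C \<in> charts_at B (zero_section x)" "u \<in> fiber \<pi> x" "u' \<in> fiber \<pi> x" "fib C u = fib C u'"
  shows "u = u'"
  using chart_over_kiso[OF assms(1)] assms(2-4) by (auto simp: kiso_def bij_betw_def inj_on_def)

section \<open>Bundle maps and their differentials\<close>

definition bundle_map :: "('f \<Rightarrow> 'f) \<Rightarrow> ('m \<Rightarrow> 'm) \<Rightarrow> bool" where
  "bundle_map f fM \<longleftrightarrow> F.C1_map f \<and>
     (\<forall>x. klinear (fiber \<pi> x) (X x) (fiber \<pi> (fM x)) (X (fM x)) f)"

lemma bundle_map_fiber: "bundle_map f fM \<Longrightarrow> u \<in> fiber \<pi> x \<Longrightarrow> f u \<in> fiber \<pi> (fM x)"
  by (auto simp: bundle_map_def klinear_def)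

lemma bundle_map_linear:
  assumes "bundle_map f fM" "u \<in> fiber \<pi> x"
  shows "u' \<in> fiber \<pi> x \<Longrightarrow> f (kadd (X x) u u') = kadd (X (fM x)) (f u) (f u')"
    and "f (kscale (X x) r u) = kscale (X (fM x)) r (f u)"
  using assms by (auto simp: bundle_map_def klinear_def)

lemma bundle_map_id: "bundle_map id id"
  by (simp add: bundle_map_def F.C1_map_id klinear_def)

lemma bundle_map_zero: "bundle_map f fM \<Longrightarrow> f (zero_section x) = zero_section (fM x)"
  by (rule klinear_zero[OF structure_fiber structure_fiber]) (simp add: bundle_map_def)

text \<open>Bundle charts are defined on unions of full fibers, so membership in the domain of a chart
  expression is a condition on the base point. This lemma and the next one translate between
  coordinates and fibers.\<close>

lemma loc_dom_fiber:
  assumes f: "bundle_map f fM" and C: "C \<in> B" "D \<in> B" and p: "p \<in> loc_dom C f D"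
  obtains x where "C \<in> charts_at B (zero_section x)" "D \<in> charts_at B (zero_section (fM x))"
    "fst p = fst (snd C (zero_section x))"
proof -
  obtain u where u: "p = snd C u" "u \<in> fst C" "f u \<in> fst D"
    using p by (auto simp: loc_dom_def)
  have ux: "u \<in> fiber \<pi> (\<pi> u)" by (simp add: fiber_def)
  have "C \<in> charts_at B u" "D \<in> charts_at B (f u)" using u C by (simp_all add: charts_at_def)
  then have "C \<in> charts_at B (zero_section (\<pi> u))" "D \<in> charts_at B (zero_section (fM (\<pi> u)))"
    using charts_at_fiber[OF ux] charts_at_fiber[OF bundle_map_fiber[OF f ux]] by simp_all
  then show thesis using that chart_over_base[OF _ ux] u(1) by simp
qed

lemma loc_map_fiber:
  assumes f: "bundle_map f fM" and C: "C \<in> charts_at B (zero_section x)"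
    and D: "D \<in> charts_at B (zero_section (fM x))" and u: "u \<in> fiber \<pi> x"
  shows "(fst (snd C (zero_section x)), fib C u) \<in> loc_dom C f D"
    and "loc_map C f D (fst (snd C (zero_section x)), fib C u) =
      (fst (snd D (zero_section (fM x))), fib D (f u))"
proof -
  have Cu: "snd C u = (fst (snd C (zero_section x)), fib C u)"
    using chart_over_base[OF C u] by (simp add: prod_eq_iff)
  have fu: "f u \<in> fiber \<pi> (fM x)" by (rule bundle_map_fiber[OF f u])
  have m: "u \<in> fst C" "f u \<in> fst D" using chart_over_mem[OF C u] chart_over_mem[OF D fu] by auto
  show "(fst (snd C (zero_section x)), fib C u) \<in> loc_dom C f D"
    using mem_loc_dom[of u C f D] m Cu by simp
  show "loc_map C f D (fst (snd C (zero_section x)), fib C u) =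
      (fst (snd D (zero_section (fM x))), fib D (f u))"
    using loc_map_apply[OF F.is_chart[OF C] m(1), of f D] chart_over_base[OF D fu]
    by (simp only: Cu[symmetric]) (simp add: prod_eq_iff)
qed

text \<open>The functions \<open>G\<close>, \<open>\<tau>\<close> and \<open>N\<close> depend on the base point \<open>x\<close> only: they describe \<open>Tf\<close> on all of
  the fiber of \<open>TF\<close> over \<open>x\<close> at once.\<close>

lemma bundle_map_deriv:
  assumes f: "bundle_map f fM" and C: "C \<in> charts_at B (zero_section x)"
    and D: "D \<in> charts_at B (zero_section (fM x))"
  obtains G \<tau> N where "module_hom sV sV G" "module_hom sE sE \<tau>"
    "\<And>w. module_hom sE sV (\<lambda>v. N v w)" "\<And>v. module_hom sV sV (\<lambda>w. N v w)"
    "\<And>u. u \<in> fiber \<pi> x \<Longrightarrow> fib D (f u) = G (fib C u)"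
    "\<And>u v z. u \<in> fiber \<pi> x \<Longrightarrow> F.chart_deriv C f D u (v, z) = (\<tau> v, N v (fib C u) + G z)"
proof -
  have CD: "C \<in> B" "D \<in> B" using C D by (auto simp: charts_at_def)
  let ?\<Omega> = "loc_dom C f D" and ?\<phi> = "loc_map C f D"
  have C1: "F.C1_map f" using f by (simp add: bundle_map_def)
  obtain g where g: "has_slope sF sF ?\<Omega> ?\<phi> g"
    using C1 CD unfolding F.C1_map_def by blast
  have \<Omega>: "(y, w') \<in> ?\<Omega>" and base: "fst (?\<phi> (y, w)) = fst (?\<phi> (y, w'))"
    and add: "snd (?\<phi> (y, w + w')) = snd (?\<phi> (y, w)) + snd (?\<phi> (y, w'))"
    and scale: "snd (?\<phi> (y, sV r w)) = sV r (snd (?\<phi> (y, w)))"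
    if yw: "(y, w) \<in> ?\<Omega>" for y w w' r
  proof -
    obtain x where x: "C \<in> charts_at B (zero_section x)" "D \<in> charts_at B (zero_section (fM x))"
      "y = fst (snd C (zero_section x))"
      using loc_dom_fiber[OF f CD yw] by auto
    obtain u where u: "u \<in> fiber \<pi> x" "fib C u = w" using fiber_point[OF x(1)] .
    obtain u' where u': "u' \<in> fiber \<pi> x" "fib C u' = w'" using fiber_point[OF x(1)] .
    note S = module_structureD[OF structure_fiber[of x]]
    note loc = loc_map_fiber[OF f x(1,2), folded x(3)]
    note fu = bundle_map_fiber[OF f u(1)] and fu' = bundle_map_fiber[OF f u'(1)]
    show "(y, w') \<in> ?\<Omega>" using loc(1)[OF u'(1)] u' by simp
    show "fst (?\<phi> (y, w)) = fst (?\<phi> (y, w'))"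
      using loc(2)[OF u(1)] loc(2)[OF u'(1)] u u' by simp
    show "snd (?\<phi> (y, w + w')) = snd (?\<phi> (y, w)) + snd (?\<phi> (y, w'))"
      using loc(2)[OF u(1)] loc(2)[OF u'(1)] loc(2)[OF S(2)[OF u(1) u'(1)]] u u'
        fib_linear(1)[OF x(1) u(1) u'(1)] fib_linear(1)[OF x(2) fu fu']
      by (simp add: bundle_map_linear(1)[OF f u(1) u'(1)])
    show "snd (?\<phi> (y, sV r w)) = sV r (snd (?\<phi> (y, w)))"
      using loc(2)[OF u(1)] loc(2)[OF S(3)[OF u(1), of r]] u
        fib_linear(2)[OF x(1) u(1), of r] fib_linear(2)[OF x(2) fu, of r]
      by (simp add: bundle_map_linear(2)[OF f u(1)])
  qed
  let ?a = "fst (snd C (zero_section x))"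
  have a: "(?a, fib C (zero_section x)) \<in> ?\<Omega>"
    by (rule loc_map_fiber(1)[OF f C D zero_section_mem])
  define G where "G z = snd (?\<phi> (?a, z))" for z
  have G: "module_hom sV sV G"
    using add[OF \<Omega>[OF a]] scale[OF \<Omega>[OF a]]
    by (simp add: module_hom_iff V.module_axioms G_def)
  obtain \<tau> N where \<tau>N: "module_hom sE sE \<tau>" "\<And>w. module_hom sE sV (\<lambda>v. N v w)"
    "\<And>v. module_hom sV sV (\<lambda>w. N v w)"
    "\<And>w v z \<phi>'. has_differential sF sF ?\<phi> (?a, w) \<phi>' \<Longrightarrow> \<phi>' (v, z) = (\<tau> v, N v w + snd (?\<phi> (?a, z)))"
    by (rule differential_linear_in_fibers[OF units F.continuous_on_mult continuous_module_E
        continuous_module_V g \<Omega> base add scale a], assumption+, rule that)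
  show thesis
  proof (rule that[OF G \<tau>N(1-3)])
    fix u assume u: "u \<in> fiber \<pi> x"
    show "fib D (f u) = G (fib C u)"
      using loc_map_fiber(2)[OF f C D u] by (simp add: G_def)
    fix v z
    have "has_differential sF sF ?\<phi> (snd C u) (F.chart_deriv C f D u)"
      by (rule F.chart_deriv_has_differential[OF C1])
        (simp_all add: charts_at_fiber[OF u] charts_at_fiber[OF bundle_map_fiber[OF f u]] C D)
    moreover have "snd C u = (?a, fib C u)"
      using chart_over_base[OF C u] by (simp add: prod_eq_iff)
    ultimately show "F.chart_deriv C f D u (v, z) = (\<tau> v, N v (fib C u) + G z)"
      using \<tau>N(4)[of "fib C u" "F.chart_deriv C f D u" v z] by (simp add: G_def)
  qed
qed

section \<open>Multiplication in charts\<close>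

abbreviation mult :: "'f \<times> 'f \<Rightarrow> 'f" where "mult \<equiv> \<lambda>(u, w). \<mu> u w"

abbreviation pair_chart :: "('f, 'e \<times> 'v) chart \<Rightarrow> ('f, 'e \<times> 'v) chart \<Rightarrow>
    ('f \<times> 'f, ('e \<times> 'v) \<times> ('e \<times> 'v)) chart" where
  "pair_chart C D \<equiv> (fst C \<times> fst D, map_prod (snd C) (snd D))"

lemma symmetric_space_F: "symmetric_space sF B \<mu>"
  using symmetric_bundle by (simp add: symmetric_bundle_def)

lemma smooth_mult: "smooth_map (prod_scale sF sF) (prod_atlas B B) sF B mult"
  using symmetric_space_F by (simp add: symmetric_space_def)

lemma smooth_mult_chart:
  assumes "C0 \<in> B" "C \<in> B" "D \<in> B"
  shows "smooth_on (prod_scale sF sF) sF (loc_dom (pair_chart C0 C) mult D)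
    (loc_map (pair_chart C0 C) mult D)"
proof -
  have "pair_chart C0 C \<in> prod_atlas B B" using assms unfolding prod_atlas_def by blast
  then show ?thesis using smooth_mult assms(3) unfolding smooth_map_def by blast
qed

lemma continuous_on_mult_left: "continuous_on UNIV (\<mu> a)"
proof -
  have "continuous_on UNIV (mult \<circ> (\<lambda>u. (a, u)))"
    using smooth_mult unfolding smooth_map_def
    by (intro continuous_on_compose continuous_intros) (auto intro: continuous_on_subset)
  then show ?thesis by (simp add: o_def)
qed

text \<open>Left multiplication by \<open>a\<close> is, in charts, the restriction of the multiplication map to the slice
  through \<open>a\<close>. Hence it inherits a difference quotient.\<close>

lemma loc_map_mult:
  assumes C: "C0 \<in> charts_at B a" "C \<in> B" and q: "q \<in> loc_dom C (\<mu> a) D"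
  shows "(snd C0 a, q) \<in> loc_dom (pair_chart C0 C) mult D"
    and "loc_map (pair_chart C0 C) mult D (snd C0 a, q) = loc_map C (\<mu> a) D q"
proof -
  obtain u where u: "q = snd C u" "u \<in> fst C" "\<mu> a u \<in> fst D" using q by (auto simp: loc_dom_def)
  have ch: "is_chart C0" "is_chart C"
    using F.is_chart[OF C(1)] F.atlas C(2) by (auto simp: is_atlas_def)
  have a: "a \<in> fst C0" using C(1) by (simp add: charts_at_def)
  show "(snd C0 a, q) \<in> loc_dom (pair_chart C0 C) mult D"
    unfolding loc_dom_def using a u by (auto intro!: image_eqI[of _ _ "(a, u)"])
  show "loc_map (pair_chart C0 C) mult D (snd C0 a, q) = loc_map C (\<mu> a) D q"
    using u by (simp add: loc_map_def chart_inv_pair[OF ch a] chart_inv_chart[OF ch(2)])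
qed

lemma continuous_module_FF: "continuous_module (prod_scale sF sF)"
  by (intro continuous_module_prod continuous_module_E continuous_module_V)

lemma module_hom_second: "module_hom sF (prod_scale sF sF) (\<lambda>q. (0, q))"
  using F.module_axioms continuous_module.axioms(1)[OF continuous_module_FF]
  by (simp add: module_hom_iff)

lemma C1_map_mult_left: "F.C1_map (\<mu> a)"
  unfolding F.C1_map_def
proof (intro ballI)
  fix C D assume C: "C \<in> B" "D \<in> B"
  obtain C0 where C0: "C0 \<in> charts_at B a" using F.charts_at_nonempty by blast
  let ?W = "loc_dom C (\<mu> a) D" and ?l = "\<lambda>q. (snd C0 a, 0) + (0, q)"
  obtain g where g: "has_slope (prod_scale sF sF) sF (loc_dom (pair_chart C0 C) mult D)
      (loc_map (pair_chart C0 C) mult D) g"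
    using smooth_on_imp_has_slope[OF smooth_mult_chart[OF F.charts_atD(1)[OF C0] C]] .
  have W: "open ?W"
    using C F.atlas by (intro open_loc_dom continuous_on_mult_left) (auto simp: is_atlas_def)
  have "has_slope sF sF ?W (loc_map (pair_chart C0 C) mult D \<circ> ?l)
      (\<lambda>(x, v, t). g (?l x, (\<lambda>(x, v, t). (0, v)) (x, v, t), t))"
  proof (rule has_slope_compose[OF has_slope_affine g W])
    show "?l ` ?W \<subseteq> loc_dom (pair_chart C0 C) mult D"
    proof
      fix p assume "p \<in> ?l ` ?W"
      then obtain q where "q \<in> ?W" "p = ?l q" by blast
      then show "p \<in> loc_dom (pair_chart C0 C) mult D"
        using loc_map_mult(1)[OF C0 C(1), of q D] by simp
    qed
  qed (auto intro!: continuous_intros F.continuous_module_axioms continuous_module_FF module_hom_second)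
  then have "has_slope sF sF ?W (loc_map C (\<mu> a) D)
      (\<lambda>(x, v, t). g (?l x, (\<lambda>(x, v, t). (0, v)) (x, v, t), t))"
    by (rule has_slope_cong) (simp add: loc_map_mult(2)[OF C0 C(1)])
  then show "\<exists>g. has_slope sF sF ?W (loc_map C (\<mu> a) D) g" by blast
qed

section \<open>Symmetries at points of the zero section\<close>

lemma symmetry_fiber: "u \<in> fiber \<pi> x \<Longrightarrow> w \<in> fiber \<pi> y \<Longrightarrow> \<mu> u w \<in> fiber \<pi> (\<mu>M x y)"
  using symmetric_bundle
  by (simp add: symmetric_bundle_def symmetric_space_hom_def fiber_def)

text \<open>Fixing the first argument \<open>0\<^sub>p\<close> in a linear map \<open>F\<^sub>p \<times> F\<^sub>x \<rightarrow> F\<^sub>\<sigma>\<^sub>p\<^sub>x\<close> leaves a linear map, since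
  \<open>0\<^sub>p\<close> is a fixed point of the operations of \<open>F\<^sub>p\<close>.\<close>

lemma bundle_map_symmetry: "bundle_map (symmetry p) (\<mu>M p)"
  unfolding bundle_map_def
proof (intro conjI allI)
  fix x
  have lin: "klinear (fiber \<pi> p \<times> fiber \<pi> x) (sum_module (X p) (X x))
              (fiber \<pi> (\<mu>M p x)) (X (\<mu>M p x)) (\<lambda>(v, w). \<mu> v w)"
    using symmetric_bundle by (simp add: symmetric_bundle_def)
  note z = zero_section_mem[of p]
  have zz: "kadd (X p) (zero_section p) (zero_section p) = zero_section p"
    using module_structureD(6)[OF structure_fiber z] .
  have rz: "kscale (X p) r (zero_section p) = zero_section p" for r
  proof -
    obtain C where C: "C \<in> charts_at B (zero_section p)" using F.charts_at_nonempty by blast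
    show ?thesis
      by (rule fib_inj[OF C module_structureD(3)[OF structure_fiber z] z])
        (simp add: fib_linear(2)[OF C z] fib_zero[OF C])
  qed
  show "klinear (fiber \<pi> x) (X x) (fiber \<pi> (\<mu>M p x)) (X (\<mu>M p x)) (symmetry p)"
    unfolding klinear_def
  proof (intro conjI ballI allI)
    fix w w' assume w: "w \<in> fiber \<pi> x" "w' \<in> fiber \<pi> x"
    then have "(zero_section p, w) \<in> fiber \<pi> p \<times> fiber \<pi> x" "(zero_section p, w') \<in> fiber \<pi> p \<times> fiber \<pi> x"
      using z by auto
    with lin have "(\<lambda>(v, w). \<mu> v w) (kadd (sum_module (X p) (X x)) (zero_section p, w) (zero_section p, w')) =
        kadd (X (\<mu>M p x)) ((\<lambda>(v, w). \<mu> v w) (zero_section p, w)) ((\<lambda>(v, w). \<mu> v w) (zero_section p, w'))"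
      unfolding klinear_def by blast
    then show "symmetry p (kadd (X x) w w') = kadd (X (\<mu>M p x)) (symmetry p w) (symmetry p w')"
      by (simp add: sum_module_def zz)
  next
    fix r w assume w: "w \<in> fiber \<pi> x"
    then have "(zero_section p, w) \<in> fiber \<pi> p \<times> fiber \<pi> x" using z by auto
    with lin have "(\<lambda>(v, w). \<mu> v w) (kscale (sum_module (X p) (X x)) r (zero_section p, w)) =
        kscale (X (\<mu>M p x)) r ((\<lambda>(v, w). \<mu> v w) (zero_section p, w))"
      unfolding klinear_def by blast
    then show "symmetry p (kscale (X x) r w) = kscale (X (\<mu>M p x)) r (symmetry p w)"
      by (simp add: sum_module_def rz)
  qed (use symmetry_fiber z in auto)
qed (rule C1_map_mult_left)

lemma symmetry_zero: "symmetry p (zero_section x) = zero_section (\<mu>M p x)"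
  by (rule bundle_map_zero[OF bundle_map_symmetry])

lemma symmetry_symmetry: "symmetry p \<circ> symmetry x = symmetry (\<mu>M p x) \<circ> symmetry p"
proof
  fix u
  have "\<mu> a (\<mu> b c) = \<mu> (\<mu> a b) (\<mu> a c)" for a b c
    using symmetric_space_F by (simp add: symmetric_space_def)
  then show "(symmetry p \<circ> symmetry x) u = (symmetry (\<mu>M p x) \<circ> symmetry p) u"
    using symmetry_zero[of p x] by (metis comp_apply)
qed

lemma \<mu>M_self: "\<mu>M x x = x"
  using symmetric_bundle by (simp add: symmetric_bundle_def symmetric_space_def)

lemma symmetry_self: "u \<in> fiber \<pi> x \<Longrightarrow> symmetry x u \<in> fiber \<pi> x"
  using symmetry_fiber[OF zero_section_mem[of x], of u x] by (simp add: \<mu>M_self)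

lemma chart_deriv_symmetry_zero:
  assumes C: "C \<in> charts_at B (zero_section x)"
  shows "F.chart_deriv C (symmetry x) C (zero_section x) w = - w"
proof (rule F.chart_deriv_eq_minus[OF C1_map_mult_left _ C])
  show "symmetry x (zero_section x) = zero_section x"
    using symmetry_zero[of x x] by (simp add: \<mu>M_self)
  fix \<xi> assume "\<xi> \<in> tangent_space sF B (zero_section x)"
  then show "tangent_map sF B sF B (symmetry x) (zero_section x) \<xi> = (\<lambda>c. - \<xi> c)"
    using symmetric_space_F by (simp add: symmetric_space_def)
qed

text \<open>The Christoffel symbol of the invariant connection: half of the derivative at \<open>y\<close>, in
  direction \<open>v\<close>, of the map which sends \<open>y'\<close> to the fiber component of the symmetry at the zero
  vector over \<open>y\<close> applied to \<open>(y', w)\<close>. It is written through the differential of the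
  multiplication map, and not of the symmetry, to make its joint smoothness in \<open>(y, v, w)\<close>
  visible.\<close>

definition christoffel :: "('f, 'e \<times> 'v) chart \<Rightarrow> 'e \<Rightarrow> 'e \<Rightarrow> 'v \<Rightarrow> 'v" where
  "christoffel C y v w = sV half (snd (differential (prod_scale sF sF) sF
     (loc_dom (pair_chart C C) mult C) (loc_map (pair_chart C C) mult C)
     ((y, 0), (y, w)) ((0, 0), (v, 0))))"

text \<open>The chain rule along the slice \<open>q \<mapsto> (0\<^sub>x, q)\<close> turns the differential of the multiplication map
  into that of the symmetry.\<close>

lemma christoffel_chart_deriv:
  assumes C: "C \<in> charts_at B (zero_section x)" and u: "u \<in> fiber \<pi> x"
  shows "christoffel C (fst (snd C u)) v (fib C u) =
    sV half (snd (F.chart_deriv C (symmetry x) C u (v, 0)))"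
proof -
  let ?m = "loc_map (pair_chart C C) mult C" and ?U = "loc_dom (pair_chart C C) mult C"
  obtain y where z: "snd C (zero_section x) = (y, 0)"
    using fib_zero[OF C] by (metis prod.collapse)
  let ?l = "\<lambda>q. ((y, 0), 0) + (0, q)"
  let ?d = "differential (prod_scale sF sF) sF ?U ?m (?l (snd C u))"
  have CB: "C \<in> B" using C by (simp add: charts_at_def)
  have base: "fst (snd C u) = y" using chart_over_base[OF C u] by (simp add: z)
  have Cu: "(y, fib C u) = snd C u" by (simp add: prod_eq_iff base)
  obtain g where g: "has_slope (prod_scale sF sF) sF ?U ?m g"
    using smooth_on_imp_has_slope[OF smooth_mult_chart[OF CB CB CB]] .
  have uC: "C \<in> charts_at B u" "C \<in> charts_at B (symmetry x u)"
    using C charts_at_fiber[OF u] charts_at_fiber[OF symmetry_self[OF u]] by simp_all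
  have W: "snd C u \<in> loc_dom C (symmetry x) C"
    using uC by (intro mem_loc_dom F.charts_atD)
  have loc: "?l q \<in> ?U" "?m (?l q) = loc_map C (symmetry x) C q" if "q \<in> loc_dom C (symmetry x) C" for q
    using loc_map_mult[OF C CB that] by (simp_all add: z)
  have "has_differential sF sF (loc_map C (symmetry x) C) (snd C u) (?d \<circ> (\<lambda>q. (0, q)))"
  proof (rule has_differential_cong)
    show "has_differential sF sF (?m \<circ> ?l) (snd C u) (?d \<circ> (\<lambda>q. (0, q)))"
    proof (rule has_differential_compose[OF F.continuous_module_axioms continuous_module_FF])
      show "has_differential sF (prod_scale sF sF) ?l (snd C u) (\<lambda>q. (0, q))"
        by (intro has_differential_affine F.continuous_module_axioms continuous_module_FF
            module_hom_second continuous_intros)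
      show "has_differential (prod_scale sF sF) sF ?m (?l (snd C u)) ?d"
        by (rule has_differential_differential[OF units continuous_module_FF
              F.continuous_module_axioms g loc(1)[OF W]])
    qed
    show "open (loc_dom C (symmetry x) C)"
      by (intro open_loc_dom continuous_on_mult_left F.is_chart[OF C])
    show "snd C u \<in> loc_dom C (symmetry x) C" by (rule W)
  qed (simp only: o_apply loc)
  then have "F.chart_deriv C (symmetry x) C u = ?d \<circ> (\<lambda>q. (0, q))"
    by (rule F.chart_deriv_eqI[OF C1_map_mult_left uC])
  then show ?thesis
    by (simp add: christoffel_def base Cu zero_prod_def[symmetric])
qed

text \<open>At the zero vector, the bilinear term of \<open>T\<sigma>\<^sub>x\<close> drops out, and \<open>T\<sigma>\<^sub>x = -id\<close> determines the
  linear terms, which are the same over all of the fiber. What remains free is the bilinear term, by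
  definition twice the Christoffel symbol.\<close>

lemma
  assumes C: "C \<in> charts_at B (zero_section x)"
  defines "b \<equiv> christoffel C (fst (snd C (zero_section x)))"
  shows christoffel_linear: "module_hom sE sV (\<lambda>v. b v w)" "module_hom sV sV (\<lambda>w. b v w)"
    and fib_symmetry: "u \<in> fiber \<pi> x \<Longrightarrow> fib C (symmetry x u) = - fib C u"
    and chart_deriv_symmetry: "u \<in> fiber \<pi> x \<Longrightarrow>
      F.chart_deriv C (symmetry x) C u (v, z) = (- v, b v (fib C u) + b v (fib C u) - z)"
proof -
  have C': "C \<in> charts_at B (zero_section (\<mu>M x x))" using C by (simp add: \<mu>M_self)
  obtain G \<tau> N where hom: "module_hom sV sV G" "module_hom sE sE \<tau>"
    "\<And>w. module_hom sE sV (\<lambda>v. N v w)" "\<And>v. module_hom sV sV (\<lambda>w. N v w)"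
    and G: "\<And>u. u \<in> fiber \<pi> x \<Longrightarrow> fib C (symmetry x u) = G (fib C u)"
    and deriv: "\<And>u v z. u \<in> fiber \<pi> x \<Longrightarrow>
       F.chart_deriv C (symmetry x) C u (v, z) = (\<tau> v, N v (fib C u) + G z)"
    using bundle_map_deriv[OF bundle_map_symmetry C C'] by blast
  interpret G: module_hom sV sV G by (rule hom)
  interpret N1: module_hom sE sV "\<lambda>v. N v w" for w by (rule hom)
  interpret N2: module_hom sV sV "\<lambda>w. N v w" for v by (rule hom)
  have "(\<tau> v, N v 0 + G z) = (- v, - z)" for v z
    using deriv[OF zero_section_mem, of v z] chart_deriv_symmetry_zero[OF C, of "(v, z)"]
    by (simp add: fib_zero[OF C])
  then have \<tau>: "\<tau> v = - v" and Gz: "G z = - z" for v z by (simp_all add: N2.zero)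
  have b: "b v w = sV half (N v w)" for v w
  proof -
    obtain u where u: "u \<in> fiber \<pi> x" "fib C u = w" using fiber_point[OF C] .
    show ?thesis
      using christoffel_chart_deriv[OF C u(1), of v] deriv[OF u(1), of v 0] u(2)
      by (simp add: b_def chart_over_base[OF C u(1)] Gz)
  qed
  have bb: "b v w + b v w = N v w" for v w
    using V.scale_left_distrib[of half half "N v w"] by (simp add: b half_plus_half)
  show "module_hom sE sV (\<lambda>v. b v w)" "module_hom sV sV (\<lambda>w. b v w)"
    by (simp_all add: module_hom_iff E.module_axioms V.module_axioms b N1.add N1.scale N2.add N2.scale
        V.scale_right_distrib mult.commute)
  show "fib C (symmetry x u) = - fib C u" if "u \<in> fiber \<pi> x"
    using G[OF that] by (simp add: Gz)
  show "F.chart_deriv C (symmetry x) C u (v, z) = (- v, b v (fib C u) + b v (fib C u) - z)"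
    if "u \<in> fiber \<pi> x"
    using deriv[OF that] by (simp add: \<tau> Gz bb)
qed

section \<open>Adapted coordinates on the fibers of TF over M\<close>

text \<open>The coordinates \<open>(u, v, z - b\<^sub>y(v, u))\<close>, in which the structure of a linear connection with
  bilinear part \<open>b\<close> is the product structure.\<close>

definition adapted_coord ::
  "('f, 'e \<times> 'v) chart \<Rightarrow> ('e \<Rightarrow> 'e \<Rightarrow> 'v \<Rightarrow> 'v) \<Rightarrow> 'f \<times> (('f, 'e \<times> 'v) chart \<Rightarrow> 'e \<times> 'v) \<Rightarrow> 'v \<times> 'e \<times> 'v"
  where "adapted_coord C b =
    (\<lambda>\<tau>. let (u, v, z) = TF_coord C \<tau>; y = fst (snd C (fst \<tau>)) in (u, v, z - b y v u))"

abbreviation "TF x \<equiv> TF_fiber sE sV B \<pi> x"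

abbreviation "sT \<equiv> prod_scale sV sF"

definition TF_map :: "('f \<Rightarrow> 'f) \<Rightarrow> 'f \<times> (('f, 'e \<times> 'v) chart \<Rightarrow> 'e \<times> 'v)
    \<Rightarrow> 'f \<times> (('f, 'e \<times> 'v) chart \<Rightarrow> 'e \<times> 'v)" where
  "TF_map f = (\<lambda>(u, \<xi>). (f u, tangent_map sF B sF B f u \<xi>))"

lemma module_sT: "module sT"
  by (intro continuous_module.axioms(1) continuous_module_prod continuous_module_E continuous_module_V)

lemma mem_TF: "(u, \<xi>) \<in> TF x \<longleftrightarrow> u \<in> fiber \<pi> x \<and> \<xi> \<in> tangent_space sF B u"
  by (simp add: TF_fiber_def)

lemma adapted_coord_apply:
  assumes "C \<in> charts_at B (zero_section x)" "u \<in> fiber \<pi> x"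
  shows "adapted_coord C b (u, \<xi>) =
    (fib C u, fst (\<xi> C), snd (\<xi> C) - b (fst (snd C (zero_section x))) (fst (\<xi> C)) (fib C u))"
  using chart_over_base[OF assms] by (simp add: adapted_coord_def TF_coord_def Let_def case_prod_unfold)

lemma TF_point:
  assumes C: "C \<in> charts_at B (zero_section x)"
  obtains u \<xi> where "(u, \<xi>) \<in> TF x" "fib C u = w" "\<xi> C = p"
proof -
  obtain u where u: "u \<in> fiber \<pi> x" "fib C u = w" using fiber_point[OF C] .
  have "C \<in> charts_at B u" using C charts_at_fiber[OF u(1)] by simp
  then obtain \<xi> where "\<xi> \<in> tangent_space sF B u" "\<xi> C = p" by (rule F.tangent_vector_exists)
  then show thesis using that u by (simp add: mem_TF)
qed

lemma adapted_coord_bij: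
  assumes C: "C \<in> charts_at B (zero_section x)"
  shows "bij_betw (adapted_coord C b) (TF x) UNIV"
  unfolding bij_betw_def
proof
  show "inj_on (adapted_coord C b) (TF x)"
  proof (rule inj_onI)
    fix p q assume p: "p \<in> TF x" and q: "q \<in> TF x" and eq: "adapted_coord C b p = adapted_coord C b q"
    obtain u \<xi> u' \<xi>' where uu: "p = (u, \<xi>)" "q = (u', \<xi>')" by (cases p, cases q) auto
    have m: "u \<in> fiber \<pi> x" "\<xi> \<in> tangent_space sF B u" "u' \<in> fiber \<pi> x" "\<xi>' \<in> tangent_space sF B u'"
      using p q by (auto simp: uu mem_TF)
    note e = eq[unfolded uu adapted_coord_apply[OF C m(1)] adapted_coord_apply[OF C m(3)]]
    have u: "u = u'" using e fib_inj[OF C m(1,3)] by simp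
    have "\<xi> C = \<xi>' C" using e by (auto simp: prod_eq_iff u)
    then have "\<xi> = \<xi>'"
      using F.tangent_vector_eqI[OF m(2), of \<xi>' C] m(4) C charts_at_fiber[OF m(1)] u by simp
    then show "p = q" using u uu by simp
  qed
  have "(w, v, r) \<in> adapted_coord C b ` TF x" for w v r
  proof -
    obtain u \<xi> where t: "(u, \<xi>) \<in> TF x" "fib C u = w"
      "\<xi> C = (v, r + b (fst (snd C (zero_section x))) v w)"
      by (rule TF_point[OF C])
    then have "adapted_coord C b (u, \<xi>) = (w, v, r)"
      by (subst adapted_coord_apply[OF C]) (auto simp: mem_TF)
    then show ?thesis using t(1) by (metis imageI)
  qed
  then show "adapted_coord C b ` TF x = UNIV" by auto
qed

lemma TF_map_mem:
  assumes "bundle_map f fM" "\<tau> \<in> TF x"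
  shows "TF_map f \<tau> \<in> TF (fM x)"
proof -
  obtain u \<xi> where \<tau>: "\<tau> = (u, \<xi>)" by (cases \<tau>)
  show ?thesis
    using assms F.tangent_map_mem[of f \<xi> u] bundle_map_fiber[OF assms(1), of u x]
    by (auto simp: \<tau> mem_TF TF_map_def bundle_map_def)
qed

lemma TF_map_coord:
  assumes f: "bundle_map f fM" and C: "C \<in> charts_at B (zero_section x)"
    and D: "D \<in> charts_at B (zero_section (fM x))" and \<tau>: "(u, \<xi>) \<in> TF x"
  shows "adapted_coord D b (TF_map f (u, \<xi>)) =
    (fib D (f u), fst (F.chart_deriv C f D u (\<xi> C)),
     snd (F.chart_deriv C f D u (\<xi> C)) -
       b (fst (snd D (zero_section (fM x)))) (fst (F.chart_deriv C f D u (\<xi> C))) (fib D (f u)))"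
proof -
  have u: "u \<in> fiber \<pi> x" "\<xi> \<in> tangent_space sF B u" using \<tau> by (auto simp: mem_TF)
  have "tangent_map sF B sF B f u \<xi> D = F.chart_deriv C f D u (\<xi> C)"
    using f C D charts_at_fiber[OF u(1)] charts_at_fiber[OF bundle_map_fiber[OF f u(1)]]
    by (intro F.tangent_map_chart u) (simp_all add: bundle_map_def)
  then show ?thesis
    by (simp add: TF_map_def adapted_coord_apply[OF D bundle_map_fiber[OF f u(1)]])
qed

text \<open>Write \<open>Tf (u, v, z) = (G u, \<tau> v, N(v, u) + G z)\<close>. Comparing the last components of
  \<open>Tf \<circ> T\<sigma>\<^sub>x = T\<sigma>\<^sub>f\<^sub>x \<circ> Tf\<close> gives \<open>\<beta>(\<tau> v, G u) = 2 N(v, u) + G \<beta>(v, u)\<close>. Halving, this is the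
  transformation rule which says that the correction by \<open>\<beta> / 2\<close> on both sides cancels \<open>N\<close>, so that
  \<open>Tf\<close> becomes \<open>(u, v, w) \<mapsto> (G u, \<tau> v, G w)\<close>.\<close>

lemma TF_map_linear:
  assumes f: "bundle_map f fM" and comm: "f \<circ> symmetry x = symmetry (fM x) \<circ> f"
    and C: "C \<in> charts_at B (zero_section x)" and D: "D \<in> charts_at B (zero_section (fM x))"
  obtains L where "module_hom sT sT L"
    "\<And>\<tau>. \<tau> \<in> TF x \<Longrightarrow>
      adapted_coord D (christoffel D) (TF_map f \<tau>) = L (adapted_coord C (christoffel C) \<tau>)"
proof -
  obtain G \<tau> N where hom: "module_hom sV sV G" "module_hom sE sE \<tau>"
    "\<And>w. module_hom sE sV (\<lambda>v. N v w)" "\<And>v. module_hom sV sV (\<lambda>w. N v w)"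
    and G: "\<And>u. u \<in> fiber \<pi> x \<Longrightarrow> fib D (f u) = G (fib C u)"
    and deriv: "\<And>u v z. u \<in> fiber \<pi> x \<Longrightarrow> F.chart_deriv C f D u (v, z) = (\<tau> v, N v (fib C u) + G z)"
    using bundle_map_deriv[OF f C D] by blast
  interpret G: module_hom sV sV G by (rule hom)
  interpret \<tau>: module_hom sE sE \<tau> by (rule hom)
  interpret N1: module_hom sE sV "\<lambda>v. N v w" for w by (rule hom)
  interpret N2: module_hom sV sV "\<lambda>w. N v w" for v by (rule hom)
  let ?bC = "christoffel C (fst (snd C (zero_section x)))"
  let ?bD = "christoffel D (fst (snd D (zero_section (fM x))))"
  have C1: "F.C1_map f" using f by (simp add: bundle_map_def)
  have twice: "?bD (\<tau> v) (G w) + ?bD (\<tau> v) (G w) = N v w + N v w + G (?bC v w + ?bC v w)" for v w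
  proof -
    obtain u where u: "u \<in> fiber \<pi> x" "fib C u = w" using fiber_point[OF C] .
    note fu = bundle_map_fiber[OF f u(1)] and su = symmetry_self[OF u(1)]
    have charts: "C \<in> charts_at B u" "C \<in> charts_at B (symmetry x u)" "D \<in> charts_at B (f u)"
      "D \<in> charts_at B (f (symmetry x u))"
      using C D charts_at_fiber[OF u(1)] charts_at_fiber[OF su] charts_at_fiber[OF fu]
        charts_at_fiber[OF bundle_map_fiber[OF f su]] by simp_all
    have "F.chart_deriv C f D (symmetry x u) (F.chart_deriv C (symmetry x) C u (v, 0)) =
        F.chart_deriv D (symmetry (fM x)) D (f u) (F.chart_deriv C f D u (v, 0))"
      by (rule F.chart_deriv_commute[OF C1_map_mult_left C1 C1 C1_map_mult_left comm charts])
    then show ?thesis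
      by (simp add: chart_deriv_symmetry[OF C u(1)] chart_deriv_symmetry[OF D fu] deriv[OF u(1)]
          deriv[OF su] fib_symmetry[OF C u(1)] u(2) G[OF u(1)] N1.neg N2.neg algebra_simps)
  qed
  have b: "?bD (\<tau> v) (G w) = N v w + G (?bC v w)" for v w
  proof -
    have "sV half (p + p) = p" for p
      using V.scale_left_distrib[of half half p] by (simp add: V.scale_right_distrib half_plus_half)
    moreover have "?bD (\<tau> v) (G w) + ?bD (\<tau> v) (G w) =
        (N v w + G (?bC v w)) + (N v w + G (?bC v w))"
      using twice[of v w] by (simp add: G.add algebra_simps)
    ultimately show ?thesis by metis
  qed
  define L where "L p = (G (fst p), \<tau> (fst (snd p)), G (snd (snd p)))" for p
  show thesis
  proof (rule that[of L])
    show "module_hom sT sT L"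
      by (simp add: module_hom_iff module_sT L_def G.add G.scale \<tau>.add \<tau>.scale)
    fix t assume t: "t \<in> TF x"
    obtain u \<xi> where u: "t = (u, \<xi>)" by (cases t)
    obtain v z where vz: "\<xi> C = (v, z)" by (cases "\<xi> C")
    have uf: "u \<in> fiber \<pi> x" using t by (simp add: u mem_TF)
    show "adapted_coord D (christoffel D) (TF_map f t) = L (adapted_coord C (christoffel C) t)"
      using t unfolding u
      by (simp add: TF_map_coord[OF f C D] adapted_coord_apply[OF C uf] vz deriv[OF uf] G[OF uf] b L_def
          G.diff)
  qed
qed

section \<open>The invariant connection\<close>

definition some_chart :: "'m \<Rightarrow> ('f, 'e \<times> 'v) chart" where
  "some_chart x = (SOME C. C \<in> charts_at B (zero_section x))"

definition connection :: "'m \<Rightarrow> ('f \<times> (('f, 'e \<times> 'v) chart \<Rightarrow> 'e \<times> 'v), 'k) kmod" where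
  "connection x = transport_module (TF x) sT (adapted_coord (some_chart x) (christoffel (some_chart x)))"

lemma some_chart_over: "some_chart x \<in> charts_at B (zero_section x)"
  unfolding some_chart_def using F.charts_at_nonempty by (rule someI_ex)

lemma connection_structure:
  "module_structure (TF x) (connection x)"
  "module_extensional (TF x) (connection x)"
  "kiso (TF x) (connection x) UNIV (type_module sT) (adapted_coord (some_chart x) (christoffel (some_chart x)))"
  unfolding connection_def by (rule transport_module[OF module_sT adapted_coord_bij[OF some_chart_over]])+

text \<open>The choice of a chart is immaterial: the identity commutes with the symmetries, so the change of
  adapted coordinates is linear.\<close>

lemma connection_kiso:
  assumes C: "C \<in> charts_at B (zero_section x)"
  shows "kiso (TF x) (connection x) UNIV (type_module sT) (adapted_coord C (christoffel C))"
proof -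
  obtain L where L: "module_hom sT sT L"
    "\<And>\<tau>. \<tau> \<in> TF x \<Longrightarrow> adapted_coord C (christoffel C) (TF_map id \<tau>) =
      L (adapted_coord (some_chart x) (christoffel (some_chart x)) \<tau>)"
    using TF_map_linear[OF bundle_map_id _ some_chart_over, of x C] C by (metis comp_id id_comp id_apply)
  have "TF_map id \<tau> = \<tau>" if "\<tau> \<in> TF x" for \<tau>
    using that F.tangent_map_id by (cases \<tau>) (simp add: TF_map_def mem_TF)
  with L(2) have "adapted_coord C (christoffel C) \<tau> = L (adapted_coord (some_chart x) (christoffel (some_chart x)) \<tau>)"
    if "\<tau> \<in> TF x" for \<tau> using that by metis
  then show ?thesis
    by (rule kiso_compose[OF connection_structure(3) L(1) adapted_coord_bij[OF C] _ connection_structure(1)])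
qed

text \<open>The symmetry \<open>\<sigma>\<^sub>x\<close> maps the fiber over \<open>x\<close> to itself, so the points \<open>((y, 0), (y, w))\<close> lie in the
  domain of the chart expression of the multiplication map for all \<open>y\<close> in the chart and all \<open>w\<close>. Hence
  a single formula is smooth over the whole chart, and nothing has to be glued.\<close>

lemma christoffel_smooth:
  assumes C: "C \<in> B"
  shows "smooth_on (prod_scale sE (prod_scale sE sV)) sV ((fst ` snd C ` fst C) \<times> UNIV \<times> UNIV)
    (\<lambda>(y, v, w). christoffel C y v w)"
proof -
  let ?W = "(fst ` snd C ` fst C) \<times> (UNIV :: 'e set) \<times> (UNIV :: 'v set)"
  let ?s = "prod_scale sE (prod_scale sE sV)"
  have cm: "continuous_module ?s"
    by (intro continuous_module_prod continuous_module_E continuous_module_V)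
  have m: "module ?s" "module (prod_scale sF sF)" "module sV"
    by (intro continuous_module.axioms(1) cm continuous_module_FF continuous_module_V)+
  have half: "module_hom sF sV (\<lambda>p. sV half (snd p))" "continuous_on UNIV (\<lambda>p. sV half (snd p))"
    by (auto simp: module_hom_iff m F.module_axioms V.scale_right_distrib mult.commute
        intro!: V.continuous_on_scale continuous_intros)
  have open_base: "open (fst ` snd C ` fst C)"
  proof -
    have "open (snd C ` fst C)" using F.atlas C by (simp add: is_atlas_def is_chart_def)
    then show ?thesis by (rule open_image_fst)
  qed
  have "smooth_on ?s sV ?W (\<lambda>q. sV half (snd (differential (prod_scale sF sF) sF
     (loc_dom (pair_chart C C) mult C) (loc_map (pair_chart C C) mult C)
     ((fst q, 0), (fst q, snd (snd q))) ((0, 0), (fst (snd q), 0)))))"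
  proof (rule smooth_on_differential_along_linear[OF units continuous_module_FF F.continuous_module_axioms
        smooth_mult_chart[OF C C C] _ _ _ _ half])
    show "module_hom ?s (prod_scale sF sF) (\<lambda>q. ((fst q, 0), (fst q, snd (snd q))))"
      "module_hom ?s (prod_scale sF sF) (\<lambda>q. ((0, 0), (fst (snd q), 0)))"
      by (simp_all add: module_hom_iff m)
    show "continuous_on UNIV (\<lambda>q. ((fst q, 0), (fst q, snd (snd q))))"
      "continuous_on UNIV (\<lambda>q. ((0, 0), (fst (snd q), 0)))"
      by (intro continuous_intros)+
    show "open ?W" using open_base by (intro open_Times) auto
    fix q assume "q \<in> ?W"
    then obtain u where u: "u \<in> fst C" "fst q = fst (snd C u)" by auto
    have ux: "u \<in> fiber \<pi> (\<pi> u)" by (simp add: fiber_def)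
    have Cx: "C \<in> charts_at B (zero_section (\<pi> u))"
      using charts_at_fiber[OF ux] u C by (auto simp: charts_at_def)
    obtain w where w: "w \<in> fiber \<pi> (\<pi> u)" "fib C w = snd (snd q)" using fiber_point[OF Cx] .
    have y: "fst (snd C (zero_section (\<pi> u))) = fst q" "fst (snd C w) = fst q"
      using chart_over_base[OF Cx ux] chart_over_base[OF Cx w(1)] u by simp_all
    have "snd C w \<in> loc_dom C (symmetry (\<pi> u)) C"
      using chart_over_mem[OF Cx] w(1) symmetry_self[OF w(1)] by (intro mem_loc_dom) auto
    from loc_map_mult(1)[OF Cx C this]
    have "(snd C (zero_section (\<pi> u)), snd C w) \<in> loc_dom (pair_chart C C) mult C" .
    moreover have "snd C (zero_section (\<pi> u)) = (fst q, 0)" "snd C w = (fst q, snd (snd q))"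
      using y w(2) fib_zero[OF Cx] by (simp_all add: prod_eq_iff)
    ultimately show "((fst q, 0), (fst q, snd (snd q))) \<in> loc_dom (pair_chart C C) mult C" by simp
  qed
  then show ?thesis by (simp add: christoffel_def case_prod_unfold)
qed

lemma adapted_coord_kiso_iff:
  "kiso (TF x) Y UNIV (sum_module (type_module sV) (sum_module (type_module sE) (type_module sV)))
     (\<lambda>\<tau>. let (u, v, z) = TF_coord C \<tau>; y = fst (snd C (fst \<tau>)) in (u, v, z - b y v u)) \<longleftrightarrow>
   kiso (TF x) Y UNIV (type_module sT) (adapted_coord C b)"
  by (simp only: sum_module_type_module adapted_coord_def)

lemma fiber_chart:
  assumes "C \<in> B"
  shows "x \<in> \<pi> ` fst C \<longleftrightarrow> C \<in> charts_at B (zero_section x)"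
proof
  assume "x \<in> \<pi> ` fst C"
  then obtain u where "u \<in> fiber \<pi> x" "u \<in> fst C" by (auto simp: fiber_def)
  then show "C \<in> charts_at B (zero_section x)"
    using charts_at_fiber[of u x] assms by (auto simp: charts_at_def)
next
  assume "C \<in> charts_at B (zero_section x)"
  then show "x \<in> \<pi> ` fst C"
    using zero_section_mem[of x] by (force simp: charts_at_def fiber_def)
qed

lemma base_chart:
  assumes "C \<in> B" "y \<in> fst ` snd C ` fst C"
  obtains x where "C \<in> charts_at B (zero_section x)" "y = fst (snd C (zero_section x))"
proof -
  obtain u where u: "u \<in> fst C" "y = fst (snd C u)" using assms by auto
  have ux: "u \<in> fiber \<pi> (\<pi> u)" by (simp add: fiber_def)
  have "C \<in> charts_at B (zero_section (\<pi> u))" using fiber_chart[OF assms(1)] u by blast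
  then show thesis using that chart_over_base[OF _ ux] u by simp
qed

lemma linear_connection_connection: "linear_connection sE sV B \<pi> connection"
  unfolding linear_connection_def adapted_coord_kiso_iff
proof (intro conjI allI ballI)
  fix C assume C: "C \<in> B"
  show "\<exists>b. smooth_on (prod_scale sE (prod_scale sE sV)) sV
          ((fst ` snd C ` fst C) \<times> UNIV \<times> UNIV) (\<lambda>(y, v, u). b y v u) \<and>
        (\<forall>y \<in> fst ` snd C ` fst C.
           (\<forall>u. module_hom sE sV (\<lambda>v. b y v u)) \<and> (\<forall>v. module_hom sV sV (\<lambda>u. b y v u))) \<and>
        (\<forall>x \<in> \<pi> ` fst C. kiso (TF x) (connection x) UNIV (type_module sT) (adapted_coord C b))"
  proof (intro exI[of _ "christoffel C"] conjI ballI allI)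
    show "kiso (TF x) (connection x) UNIV (type_module sT) (adapted_coord C (christoffel C))"
      if "x \<in> \<pi> ` fst C" for x
      using that by (intro connection_kiso) (simp add: fiber_chart[OF C])
    fix y assume "y \<in> fst ` snd C ` fst C"
    then obtain x where x: "C \<in> charts_at B (zero_section x)" "y = fst (snd C (zero_section x))"
      by (rule base_chart[OF C])
    show "module_hom sE sV (\<lambda>v. christoffel C y v u)" for u
      using christoffel_linear(1)[OF x(1)] x(2) by simp
    show "module_hom sV sV (\<lambda>u. christoffel C y v u)" for v
      using christoffel_linear(2)[OF x(1)] x(2) by simp
  qed (rule christoffel_smooth[OF C])
qed (rule connection_structure(1) connection_structure(2))+

lemma connection_invariant: "invariant_connection sE sV B \<pi> (symmetry p) (\<mu>M p) connection"
  unfolding invariant_connection_def TF_map_def[symmetric]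
proof
  fix x
  obtain L where L: "module_hom sT sT L"
    "\<And>\<tau>. \<tau> \<in> TF x \<Longrightarrow>
      adapted_coord (some_chart (\<mu>M p x)) (christoffel (some_chart (\<mu>M p x))) (TF_map (symmetry p) \<tau>) =
      L (adapted_coord (some_chart x) (christoffel (some_chart x)) \<tau>)"
    using TF_map_linear[OF bundle_map_symmetry[of p] symmetry_symmetry[of p x] some_chart_over[of x]
        some_chart_over[of "\<mu>M p x"]] by blast
  show "klinear (TF x) (connection x) (TF (\<mu>M p x)) (connection (\<mu>M p x)) (TF_map (symmetry p))"
    using TF_map_mem[OF bundle_map_symmetry]
    by (intro klinear_in_coordinates[OF connection_structure(3) connection_structure(3)
          connection_structure(1) connection_structure(1) _ L]) auto
qed

text \<open>In the coordinates adapted to the given connection, with bilinear part \<open>b\<close>, the elements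
  \<open>(w, 0, 0)\<close> and \<open>(0, v, 0)\<close> have the sum \<open>(w, v, 0)\<close>. The bilinear defect \<open>(\<beta> - 2 b)(v, w)\<close> in the last component of \<open>T\<sigma>\<^sub>x\<close> vanishes on both summands,
  hence by linearity of \<open>T\<sigma>\<^sub>x\<close> also on the sum.\<close>

lemma connection_unique:
  assumes lc: "linear_connection sE sV B \<pi> \<Gamma>"
    and inv: "\<And>x. invariant_connection sE sV B \<pi> (symmetry x) (\<mu>M x) \<Gamma>"
  shows "\<Gamma> = connection"
proof
  fix x
  define C where "C = some_chart x"
  have C: "C \<in> charts_at B (zero_section x)" unfolding C_def by (rule some_chart_over)
  then have CB: "C \<in> B" by (simp add: charts_at_def)
  define y where "y = fst (snd C (zero_section x))"
  have x: "x \<in> \<pi> ` fst C" using fiber_chart[OF CB] C by simp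
  have yC: "y \<in> fst ` snd C ` fst C" unfolding y_def using C by (auto simp: charts_at_def)
  have st: "module_structure (TF x) (\<Gamma> x)" "module_extensional (TF x) (\<Gamma> x)"
    using lc by (simp_all add: linear_connection_def)
  obtain b where b: "\<And>u. module_hom sE sV (\<lambda>v. b y v u)" "\<And>v. module_hom sV sV (\<lambda>u. b y v u)"
    and \<Psi>: "kiso (TF x) (\<Gamma> x) UNIV (type_module sT) (adapted_coord C b)"
    using lc CB x yC unfolding linear_connection_def adapted_coord_kiso_iff by blast
  interpret b1: module_hom sE sV "\<lambda>v. b y v w" for w by (rule b)
  interpret b2: module_hom sV sV "\<lambda>w. b y v w" for v by (rule b)
  interpret c1: module_hom sE sV "\<lambda>v. christoffel C y v w" for w
    using christoffel_linear(1)[OF C] by (simp add: y_def)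
  interpret c2: module_hom sV sV "\<lambda>w. christoffel C y v w" for v
    using christoffel_linear(2)[OF C] by (simp add: y_def)
  let ?T = "TF_map (symmetry x)" and ?\<Psi> = "adapted_coord C b"
  have lin: "klinear (TF x) (\<Gamma> x) (TF x) (\<Gamma> x) ?T"
    using inv[of x, unfolded invariant_connection_def, rule_format, of x]
    by (simp add: TF_map_def \<mu>M_self)
  have T: "?\<Psi> (?T \<tau>) = (- w, - v, christoffel C y v w + christoffel C y v w - b y v w - b y v w - r)"
    if \<tau>: "\<tau> \<in> TF x" "?\<Psi> \<tau> = (w, v, r)" for \<tau> w v r
  proof -
    obtain u \<xi> where u: "\<tau> = (u, \<xi>)" by (cases \<tau>)
    have uf: "u \<in> fiber \<pi> x" using \<tau> by (simp add: u mem_TF)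
    have C': "C \<in> charts_at B (zero_section (\<mu>M x x))" using C by (simp add: \<mu>M_self)
    have co: "fib C u = w" "fst (\<xi> C) = v" "snd (\<xi> C) = r + b y v w"
      using \<tau>(2) by (auto simp: u adapted_coord_apply[OF C uf] y_def)
    then have \<xi>: "\<xi> C = (v, r + b y v w)" by (simp add: prod_eq_iff)
    show ?thesis
      using TF_map_coord[OF bundle_map_symmetry C C', of u \<xi> b] \<tau>(1)
      by (simp add: u \<mu>M_self \<xi> chart_deriv_symmetry[OF C uf] fib_symmetry[OF C uf] co b1.neg b2.neg
          flip: y_def)
  qed
  have bc: "b y v w = christoffel C y v w" for v w
  proof -
    have "\<exists>\<tau>\<in>TF x. ?\<Psi> \<tau> = p" for p
      using adapted_coord_bij[OF C, of b] by (metis UNIV_I bij_betw_def imageE)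
    then obtain \<tau>1 \<tau>2 where \<tau>1: "\<tau>1 \<in> TF x" "?\<Psi> \<tau>1 = (w, 0, 0)" and \<tau>2: "\<tau>2 \<in> TF x" "?\<Psi> \<tau>2 = (0, v, 0)"
      by metis
    let ?\<tau> = "kadd (\<Gamma> x) \<tau>1 \<tau>2"
    have add: "?\<Psi> (kadd (\<Gamma> x) p q) = ?\<Psi> p + ?\<Psi> q" if "p \<in> TF x" "q \<in> TF x" for p q
      using \<Psi> that by (simp add: kiso_def klinear_def type_module_def)
    have \<tau>: "?\<tau> \<in> TF x" "?\<Psi> ?\<tau> = (w, v, 0)"
      using module_structureD(2)[OF st(1) \<tau>1(1) \<tau>2(1)] add[OF \<tau>1(1) \<tau>2(1)] \<tau>1 \<tau>2 by simp_all
    have mem: "?T \<tau>1 \<in> TF x" "?T \<tau>2 \<in> TF x" using lin \<tau>1 \<tau>2 by (auto simp: klinear_def)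
    have "?T ?\<tau> = kadd (\<Gamma> x) (?T \<tau>1) (?T \<tau>2)" using lin \<tau>1 \<tau>2 by (simp add: klinear_def)
    then have "?\<Psi> (?T ?\<tau>) = ?\<Psi> (?T \<tau>1) + ?\<Psi> (?T \<tau>2)" using add[OF mem] by simp
    then have "christoffel C y v w + christoffel C y v w - b y v w - b y v w = 0"
      by (simp add: T[OF \<tau>] T[OF \<tau>1] T[OF \<tau>2] c1.zero c2.zero b1.zero b2.zero)
    then have "christoffel C y v w + christoffel C y v w = b y v w + b y v w"
      by (simp add: algebra_simps)
    moreover have "sV half (p + p) = p" for p
      using V.scale_left_distrib[of half half p] by (simp add: V.scale_right_distrib half_plus_half)
    ultimately show ?thesis by metis
  qed
  have "?\<Psi> \<tau> = adapted_coord C (christoffel C) \<tau>" if "\<tau> \<in> TF x" for \<tau>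
  proof -
    obtain u \<xi> where u: "\<tau> = (u, \<xi>)" by (cases \<tau>)
    have "u \<in> fiber \<pi> x" using that by (simp add: u mem_TF)
    then show ?thesis by (simp add: u adapted_coord_apply[OF C] bc flip: y_def)
  qed
  then have "kiso (TF x) (\<Gamma> x) UNIV (type_module sT) (adapted_coord C (christoffel C))"
    using kiso_compose[OF \<Psi>, of sT id "adapted_coord C (christoffel C)"] adapted_coord_bij[OF C] st(1)
    by (simp add: module_hom_iff module_sT)
  then show "\<Gamma> x = connection x"
    unfolding connection_def C_def[symmetric] by (rule kiso_eq_transport_module[OF module_sT st])
qed

end

theorem theorem5p1:
  fixes sE :: "'k::{comm_ring_1, topological_ab_group_add, topological_semigroup_mult}
      \<Rightarrow> 'e::{topological_ab_group_add, t2_space} \<Rightarrow> 'e"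
    and sV :: "'k \<Rightarrow> 'v::{topological_ab_group_add, t2_space} \<Rightarrow> 'v"
    and A :: "('m::topological_space, 'e) chart set"
    and B :: "('f::topological_space, 'e \<times> 'v) chart set"
    and \<pi> :: "'f \<Rightarrow> 'm"
    and X :: "'m \<Rightarrow> ('f, 'k) kmod"
    and \<mu>M :: "'m \<Rightarrow> 'm \<Rightarrow> 'm"
    and \<mu> :: "'f \<Rightarrow> 'f \<Rightarrow> 'f"
  assumes dense_units: "closure {r::'k. r dvd 1} = UNIV"
    and two_invertible: "(2::'k) dvd 1"
    and "topological_module sE" and "topological_module sV"
    and "symmetric_bundle sE sV A B \<pi> X \<mu>M \<mu>"
  shows "\<exists>!\<Gamma>. linear_connection sE sV B \<pi> \<Gamma> \<and>
           (\<forall>x. invariant_connection sE sV B \<pi> (\<mu> (kzero (X x))) (\<mu>M x) \<Gamma>)"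
proof -
  interpret symmetric_bundle_setting sE sV A B \<pi> X \<mu>M \<mu>
    by (rule symmetric_bundle_setting.intro) (fact assms)+
  show ?thesis
    using linear_connection_connection connection_invariant connection_unique by blast
qed

end
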